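(* For each $n$ let $G$ be a random $(d_L,d_R)$-biregular bipartite graph on $m+n$ vertices with adjacency matrix $A$, and suppose that (i) $\lim_{n\to\infty} d_R=\infty$; (ii) for any fixed $\epsilon>0$, $d_R=o(n^{\epsilon})$; (iii) $d_R/d_L\to y$ as $n\to\infty$, where $1\le y<\infty$. Let $a=1-y^{-1/2}$, $b=1+y^{-1/2}$. Then the empirical spectral distribution of $d_R^{-1/2}A$ converges almost surely, as $n\to\infty$, to the distribution $\mu$ which consists of the density $$\frac{2}{1+y}\,p(x^2)|x|=\frac{y}{(1+y)\pi|x|}\sqrt{(b^2-x^2)(x^2-a^2)}$$ on $[-b,-a]\cup[a,b]$, where $p(x)=\frac{y}{2\pi x}\sqrt{(b^2-x)(x-a^2)}$ for $x \in [a^2,b^2]$, along with a point mass of $\frac{y-1}{y+1}$ at $0$.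
   Context: Graphs have no loops or parallel edges. A bipartite graph with vertex classes $L$ (left) and $R$ (right) is $(d_L,d_R)$-biregular if every vertex in $L$ has degree $d_L$ and every vertex in $R$ has degree $d_R$. It is always assumed that $d_R\ge d_L$ (hence $|L|\ge|R|$). A random $(d_L,d_R)$-biregular bipartite graph on $m+n$ vertices is a graph chosen uniformly from all $(d_L,d_R)$-biregular bipartite graphs with $|L|=m$, $|R|=n$ (so $md_L=nd_R$). One considers a sequence of such random graphs indexed by $n\to\infty$, where $m,d_L,d_R$ depend on $n$; all graphs are defined on one probability space, with arbitrary joint distribution. The empirical spectral distribution (ESD) of a symmetric $N\times N$ matrix with eigenvalues $\lambda_1,\dots,\lambda_N$ is the probability measure $\frac1N\sum_{i=1}^N\delta_{\lambda_i}$. A sequence of random probability measures $\mu_n$ on $\mathbb{R}$ converges almost surely to a deterministic probability measure $\mu$ if $\int f\,d\mu_n\to\int f\,d\mu$ almost surely for all bounded continuous $f:\mathbb{R}\to\mathbb{R}$. *)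

theory Defs
  imports
    "HOL-Probability.Probability"
    "Jordan_Normal_Form.Char_Poly"
begin

unbundle no vec_syntax

text \<open>
  A simple graph on a set of natural numbers is given by its set of edges, each edge being a
  set of two distinct vertices. The vertex classes are \<open>L = {..<m}\<close> and \<open>R = {m..<m + n}\<close>.
\<close>

definition bipartite_edges :: "nat set \<Rightarrow> nat set \<Rightarrow> nat set set" where
  "bipartite_edges L R = {{u, v} | u v. u \<in> L \<and> v \<in> R}"

definition vertex_degree :: "nat set set \<Rightarrow> nat \<Rightarrow> nat" where
  "vertex_degree E v = card {e \<in> E. v \<in> e}"

definition biregular :: "nat set \<Rightarrow> nat set \<Rightarrow> nat \<Rightarrow> nat \<Rightarrow> nat set set \<Rightarrow> bool" where
  "biregular L R dL dR E \<longleftrightarrow>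
     E \<subseteq> bipartite_edges L R \<and>
     (\<forall>u\<in>L. vertex_degree E u = dL) \<and>
     (\<forall>v\<in>R. vertex_degree E v = dR)"

definition biregular_graphs :: "nat \<Rightarrow> nat \<Rightarrow> nat \<Rightarrow> nat \<Rightarrow> nat set set set" where
  "biregular_graphs m n dL dR = {E. biregular {..<m} {m..<m + n} dL dR E}"

definition adjacency_mat :: "nat \<Rightarrow> nat set set \<Rightarrow> real mat" where
  "adjacency_mat N E = mat N N (\<lambda>(i, j). if {i, j} \<in> E then 1 else 0)"

definition random_biregular_graph ::
  "'w measure \<Rightarrow> nat \<Rightarrow> nat \<Rightarrow> nat \<Rightarrow> nat \<Rightarrow> ('w \<Rightarrow> nat set set) \<Rightarrow> bool" where
  "random_biregular_graph M m n dL dR G \<longleftrightarrow>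
     G \<in> M \<rightarrow>\<^sub>M count_space (biregular_graphs m n dL dR) \<and>
     distr M (count_space (biregular_graphs m n dL dR)) G =
       uniform_count_measure (biregular_graphs m n dL dR)"

lemma finite_biregular_graphs: "finite (biregular_graphs m n dL dR)"
proof (rule finite_subset)
  show "biregular_graphs m n dL dR \<subseteq> Pow (Pow {..<m + n})"
    unfolding biregular_graphs_def biregular_def bipartite_edges_def by fastforce
qed simp

lemma adjacency_mat_carrier [simp]: "adjacency_mat N E \<in> carrier_mat N N"
  by (simp add: adjacency_mat_def)

lemma transpose_adjacency_mat: "(adjacency_mat N E)\<^sup>T = adjacency_mat N E"
  by (rule eq_matI) (auto simp: adjacency_mat_def insert_commute)

text \<open>The eigenvalues, with multiplicity, are the roots of the characteristic polynomial. For a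
  symmetric \<open>N \<times> N\<close> matrix there are exactly \<open>N\<close> of them (\<open>size_proots_char_poly\<close> below).\<close>

definition esd :: "real mat \<Rightarrow> real measure" where
  "esd A = distr (measure_pmf (pmf_of_multiset (proots (char_poly A)))) borel (\<lambda>x. x)"

lemma hermitian_eigenvalue_real:
  fixes A :: "real mat"
  assumes A: "A \<in> carrier_mat n n" and sym: "A\<^sup>T = A"
    and ev: "eigenvalue (map_mat complex_of_real A) z"
  shows "z \<in> \<real>"
proof -
  let ?B = "map_mat complex_of_real A"
  have B: "?B \<in> carrier_mat n n" using A by simp
  from ev obtain v where v: "v \<in> carrier_vec n" "v \<noteq> 0\<^sub>v n" "?B *\<^sub>v v = z \<cdot>\<^sub>v v"
    using A by (auto simp: eigenvalue_def eigenvector_def)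
  have S: "A $$ (i, j) = A $$ (j, i)" if "i < n" "j < n" for i j
    using sym that A by (metis carrier_matD index_transpose_mat(1))
  define s where "s = (\<Sum>i<n. v $ i * cnj (v $ i))"
  define t where "t = (\<Sum>i<n. (\<Sum>j<n. of_real (A $$ (i, j)) * v $ j) * cnj (v $ i))"
  have e: "(\<Sum>j<n. of_real (A $$ (i, j)) * v $ j) = z * v $ i" if "i < n" for i
  proof -
    have "(?B *\<^sub>v v) $ i = z * v $ i" using v that by simp
    moreover have "(?B *\<^sub>v v) $ i = (\<Sum>j<n. of_real (A $$ (i, j)) * v $ j)"
      using A v(1) that by (auto simp: scalar_prod_def lessThan_atLeast0 intro!: sum.cong)
    ultimately show ?thesis by simp
  qed
  have t1: "t = z * s"
    unfolding t_def s_def sum_distrib_left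
    by (rule sum.cong) (simp_all only: lessThan_iff e mult.assoc)
  have t2: "cnj t = t"
  proof -
    have "cnj t = (\<Sum>i<n. \<Sum>j<n. of_real (A $$ (i, j)) * cnj (v $ j) * v $ i)"
      unfolding t_def by (simp add: sum_distrib_right)
    also have "\<dots> = (\<Sum>j<n. \<Sum>i<n. of_real (A $$ (i, j)) * cnj (v $ j) * v $ i)"
      by (rule sum.swap)
    also have "\<dots> = t"
      unfolding t_def sum_distrib_right
      by (intro sum.cong refl) (auto simp: S algebra_simps)
    finally show ?thesis .
  qed
  have s1: "s = of_real (\<Sum>i<n. (cmod (v $ i))\<^sup>2)"
    unfolding s_def by (simp only: complex_norm_square of_real_sum)
  have "(\<Sum>i<n. (cmod (v $ i))\<^sup>2) \<noteq> 0"
  proof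
    assume "(\<Sum>i<n. (cmod (v $ i))\<^sup>2) = 0"
    hence "\<forall>i<n. v $ i = 0" by (subst (asm) sum_nonneg_eq_0_iff) auto
    hence "v = 0\<^sub>v n" using v(1) by (intro eq_vecI) auto
    with v(2) show False by simp
  qed
  hence "s \<noteq> 0" unfolding s1 of_real_eq_0_iff .
  moreover have "cnj s = s" unfolding s1 by simp
  ultimately have "cnj z = z" using t1 t2 by simp
  thus ?thesis by (simp add: Reals_cnj_iff)
qed

lemma size_proots_char_poly:
  fixes A :: "real mat"
  assumes A: "A \<in> carrier_mat n n" and sym: "A\<^sup>T = A"
  shows "size (proots (char_poly A)) = n"
proof -
  interpret hp: map_poly_inj_comm_ring_hom complex_of_real ..
  let ?B = "map_mat complex_of_real A"
  have B: "?B \<in> carrier_mat n n" using A by simp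
  obtain as where as: "char_poly ?B = (\<Prod>a\<leftarrow>as. [:- a, 1:])" "length as = n"
    using char_poly_factorized[OF B] by blast
  have "a \<in> \<real>" if "a \<in> set as" for a
  proof (rule hermitian_eigenvalue_real[OF A sym])
    have "poly (char_poly ?B) a = 0"
      using that unfolding as(1) by (auto simp: poly_prod_list prod_list_zero_iff)
    thus "eigenvalue ?B a" using eigenvalue_root_char_poly[OF B] by simp
  qed
  hence "map (complex_of_real \<circ> Re) as = as"
    by (intro map_idI) (auto simp: complex_is_Real_iff complex_eq_iff)
  hence "map complex_of_real (map Re as) = as" by simp
  hence "char_poly ?B = (\<Prod>a\<leftarrow>map complex_of_real (map Re as). [:- a, 1:])"
    by (simp only: as(1))
  also have "\<dots> = (\<Prod>a\<leftarrow>map Re as. [:- complex_of_real a, 1:])"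
    by (simp only: map_map o_def)
  also have "\<dots> = map_poly complex_of_real (\<Prod>a\<leftarrow>map Re as. [:- a, 1:])"
    by (induction as) (simp_all add: hp.hom_mult del: mult_pCons_left)
  finally have "map_poly complex_of_real (char_poly A) =
      map_poly complex_of_real (\<Prod>a\<leftarrow>map Re as. [:- a, 1:])"
    by (simp only: of_real_hom.char_poly_hom[OF A])
  hence "char_poly A = (\<Prod>a\<leftarrow>map Re as. [:- a, 1:])"
    by (rule hp.injectivity)
  moreover have "size (proots (\<Prod>a\<leftarrow>bs. [:- a, 1:])) = length bs" for bs :: "real list"
  proof (induction bs)
    case (Cons b bs)
    have "(\<Prod>a\<leftarrow>bs. [:- a, 1:]) \<noteq> (0 :: real poly)"
      by (auto simp: prod_list_zero_iff)
    thus ?case using Cons by (simp add: proots_mult del: mult_pCons_left)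
  qed simp
  ultimately show ?thesis using as(2) by (metis length_map)
qed

lemma integral_esd:
  fixes A :: "real mat" and f :: "real \<Rightarrow> real"
  assumes A: "A \<in> carrier_mat n n" and sym: "A\<^sup>T = A" and n: "n > 0"
    and f: "f \<in> borel_measurable borel"
  shows "(\<integral>x. f x \<partial>esd A) = (\<Sum>x\<in>#proots (char_poly A). f x) / real n"
proof -
  let ?P = "proots (char_poly A)"
  have sz: "size ?P = n" by (rule size_proots_char_poly[OF A sym])
  hence ne: "?P \<noteq> {#}" using n by auto
  have "(\<integral>x. f x \<partial>esd A) = (\<integral>x. f x \<partial>measure_pmf (pmf_of_multiset ?P))"
    unfolding esd_def using f by (subst integral_distr) auto
  also have "\<dots> = (\<Sum>x\<in>set_mset ?P. f x * pmf (pmf_of_multiset ?P) x)"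
    by (rule integral_measure_pmf_real) (auto simp: ne)
  also have "\<dots> = (\<Sum>x\<in>set_mset ?P. real (count ?P x) * f x) / real n"
    unfolding sum_divide_distrib by (intro sum.cong refl) (simp add: ne sz del: count_proots)
  also have "(\<Sum>x\<in>set_mset ?P. real (count ?P x) * f x) = (\<Sum>x\<in>#?P. f x)"
  proof -
    have "(\<Sum>x\<in>#Q. f x) = (\<Sum>x\<in>set_mset Q. real (count Q x) * f x)" for Q
    proof (induction Q)
      case (add q Q)
      show ?case
      proof (cases "q \<in># Q")
        case True
        have "(\<Sum>x\<in>set_mset Q. real (count (add_mset q Q) x) * f x) =
            (\<Sum>x\<in>set_mset Q. real (count Q x) * f x + (if x = q then f x else 0))"
          by (intro sum.cong) (auto simp: algebra_simps)
        also have "\<dots> = (\<Sum>x\<in>set_mset Q. real (count Q x) * f x) + f q"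
          using True by (simp add: sum.distrib)
        finally show ?thesis using True add.IH by (simp add: insert_absorb)
      next
        case False
        hence "(\<Sum>x\<in>set_mset Q. real (count (add_mset q Q) x) * f x) =
            (\<Sum>x\<in>set_mset Q. real (count Q x) * f x)"
          by (intro sum.cong) auto
        thus ?thesis using False add.IH by (simp add: not_in_iff)
      qed
    qed simp
    thus ?thesis ..
  qed
  finally show ?thesis .
qed

text \<open>The exceptional null set is allowed to depend on \<open>f\<close>.\<close>

definition converges_AS :: "'w measure \<Rightarrow> (nat \<Rightarrow> 'w \<Rightarrow> real measure) \<Rightarrow> real measure \<Rightarrow> bool" where
  "converges_AS M \<nu> \<mu> \<longleftrightarrow>
     (\<forall>f::real \<Rightarrow> real. continuous_on UNIV f \<and> bounded (range f) \<longrightarrow>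
        (AE \<omega> in M. (\<lambda>k. \<integral>x. f x \<partial>(\<nu> k \<omega>)) \<longlonglongrightarrow> (\<integral>x. f x \<partial>\<mu>)))"

definition lower_edge :: "real \<Rightarrow> real" where
  "lower_edge y = 1 - y powr (- 1 / 2)"

definition upper_edge :: "real \<Rightarrow> real" where
  "upper_edge y = 1 + y powr (- 1 / 2)"

definition mp_density :: "real \<Rightarrow> real \<Rightarrow> real" where
  "mp_density y x = y / (2 * pi * x) *
     sqrt (((upper_edge y)\<^sup>2 - x) * (x - (lower_edge y)\<^sup>2))"

definition limit_support :: "real \<Rightarrow> real set" where
  "limit_support y =
     {- upper_edge y .. - lower_edge y} \<union> {lower_edge y .. upper_edge y}"

definition limit_density :: "real \<Rightarrow> real \<Rightarrow> real" where
  "limit_density y x = 2 / (1 + y) * mp_density y (x\<^sup>2) * \<bar>x\<bar>"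

definition limit_measure :: "real \<Rightarrow> real measure" where
  "limit_measure y = measure_of UNIV (sets borel)
     (\<lambda>B. (\<integral>\<^sup>+x\<in>limit_support y \<inter> B. ennreal (limit_density y x) \<partial>lborel) +
          ennreal ((y - 1) / (y + 1)) * indicator B 0)"

lemma limit_density_eq:
  "limit_density y x = y / ((1 + y) * pi * \<bar>x\<bar>) *
     sqrt (((upper_edge y)\<^sup>2 - x\<^sup>2) * (x\<^sup>2 - (lower_edge y)\<^sup>2))"
proof (cases "x = 0")
  case False
  define S where "S = sqrt (((upper_edge y)\<^sup>2 - x\<^sup>2) * (x\<^sup>2 - (lower_edge y)\<^sup>2))"
  define z where "z = \<bar>x\<bar>"
  have z: "z \<noteq> 0" "x\<^sup>2 = z * z" using False by (simp_all add: z_def power2_eq_square)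
  have "limit_density y x = 2 / (1 + y) * (y / (2 * pi * (z * z)) * S) * z"
    by (simp only: limit_density_def mp_density_def S_def flip: z z_def)
  also have "\<dots> = y / ((1 + y) * pi * z) * S" using z(1) by simp
  finally show ?thesis by (simp only: S_def z_def)
qed (simp add: limit_density_def mp_density_def)

lemma sets_limit_measure [simp]: "sets (limit_measure y) = sets borel"
  unfolding limit_measure_def
  using sets.sigma_sets_eq[of "borel :: real measure"] by simp

lemma limit_density_measurable [measurable]: "limit_density y \<in> borel_measurable borel"
  unfolding limit_density_def mp_density_def by measurable

lemma emeasure_limit_measure:
  assumes B: "B \<in> sets borel"
  shows "emeasure (limit_measure y) B =
     (\<integral>\<^sup>+x\<in>limit_support y \<inter> B. ennreal (limit_density y x) \<partial>lborel) +
     ennreal ((y - 1) / (y + 1)) * indicator B 0"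
proof -
  define D where
    "D = density lborel (\<lambda>x. ennreal (limit_density y x) * indicator (limit_support y) x)"
  define P where "P = return borel (0::real)"
  let ?c = "ennreal ((y - 1) / (y + 1))"
  let ?\<mu> = "\<lambda>B. (\<integral>\<^sup>+x\<in>limit_support y \<inter> B. ennreal (limit_density y x) \<partial>lborel) +
          ?c * indicator B 0"
  have [measurable]: "limit_support y \<in> sets borel" unfolding limit_support_def by simp
  have sD: "sets D = sets borel" and sP: "sets P = sets borel" by (simp_all add: D_def P_def)
  have eq: "?\<mu> X = emeasure D X + ?c * emeasure P X" if "X \<in> sets borel" for X
  proof -
    have "emeasure D X = (\<integral>\<^sup>+x\<in>limit_support y \<inter> X. ennreal (limit_density y x) \<partial>lborel)"
      unfolding D_def using that
      by (subst emeasure_density) (auto intro!: nn_integral_cong simp: indicator_def)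
    thus ?thesis using that by (simp add: P_def)
  qed
  have "countably_additive (sets borel) ?\<mu>"
  proof (rule countably_additiveI)
    fix X :: "nat \<Rightarrow> real set"
    assume X: "range X \<subseteq> sets borel" "disjoint_family X" "\<Union> (range X) \<in> sets borel"
    have "(\<Sum>i. ?\<mu> (X i)) = (\<Sum>i. emeasure D (X i) + ?c * emeasure P (X i))"
      using X by (intro suminf_cong eq) auto
    also have "\<dots> = (\<Sum>i. emeasure D (X i)) + ?c * (\<Sum>i. emeasure P (X i))"
      by (subst suminf_add[symmetric]) auto
    also have "\<dots> = emeasure D (\<Union> (range X)) + ?c * emeasure P (\<Union> (range X))"
      using suminf_emeasure[of X D] suminf_emeasure[of X P] X by (simp add: sD sP)
    also have "\<dots> = ?\<mu> (\<Union> (range X))" using eq X(3) by simp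
    finally show "(\<Sum>i. ?\<mu> (X i)) = ?\<mu> (\<Union> (range X))" .
  qed
  moreover have "positive (sets borel) ?\<mu>" by (simp add: positive_def)
  ultimately show ?thesis
    by (intro emeasure_measure_of[OF limit_measure_def]) (use B in auto)
qed

end

theory Submission
  imports Defs "Jordan_Normal_Form.Schur_Decomposition"
begin

text \<open>
  By the method of moments it suffices to control the closed walks of the graph. The number of
  non-backtracking walks satisfies a three-term recursion under multiplication by the adjacency
  matrix, so that, seen from a vertex of \<open>R\<close>, the powers of the scaled adjacency matrix are
  combinations of non-backtracking walk counts whose coefficients converge to those of the
  orthogonal polynomials of the limit. Closed non-backtracking walks exist only near short cycles.
  A switching argument bounds the probability of containing \<open>k\<close> given edges by \<open>(2 dL / n)\<^sup>k\<close>, hence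
  the second moment of the number of short cycles by a power of \<open>dR\<close>, which is \<open>n\<^sup>o\<^sup>(\<^sup>1\<^sup>)\<close>; by
  Chebyshev and Borel--Cantelli there are almost surely fewer than \<open>n\<^sup>3\<^sup>/\<^sup>4\<close> of them. On the side of
  the limit, \<open>x\<^sup>2 = 1 + r\<^sup>2 + 2 r cos \<theta>\<close> with \<open>r = y\<^sup>-\<^sup>1\<^sup>/\<^sup>2\<close> turns the orthogonal polynomials into
  combinations of \<open>sin (k \<theta>) / sin \<theta>\<close>.
\<close>

subsection \<open>Switchings\<close>

text \<open>Only walks from \<open>R\<close> are expanded: the degrees along them alternate in the
  same way for every starting vertex, so one recursion serves all. Rotating a closed walk by one
  step shows that both classes contribute equally to the trace of a positive power. The power 0 is
  the exception, and there the atom (y - 1) / (y + 1) enters; the factor 2 n / (m + n) in front of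
  the other traces tends to 2 / (1 + y), the mass of the density. Bounds may be crude in
  \<open>dR\<close>, every power of which is n^o(1), but not in n. The exponent 3/4 stands for any
  number strictly between 1/2 and 1: below 1, the cycles are negligible against n; above 1/2, the
  Chebyshev bound n^(-3/2 + o(1)) is summable, whereas a first moment bound n^(-3/4 + o(1)) would
  not be. The scaled matrix has the eigenvalue sqrt(dL), which tends to infinity, so the spectra lie
  in no common compact interval. Polynomial approximation therefore has to be paired with a high
  moment that controls the tails.\<close>

lemma bipartite_edges_iff:
  assumes "L \<inter> R = {}" "u \<in> L" "v \<in> R"
  shows "{u, v} \<in> bipartite_edges L R"
  using assms by (auto simp: bipartite_edges_def)

definition switch :: "nat \<Rightarrow> nat \<Rightarrow> nat \<Rightarrow> nat \<Rightarrow> nat set set \<Rightarrow> nat set set" where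
  "switch u v u' v' E = (E - {{u, v}, {u', v'}}) \<union> {{u, v'}, {u', v}}"

text \<open>\<open>P\<close> will be incidence with one of the four vertices of a switching, which
  lies on exactly one removed edge \<open>a\<close> and one inserted edge \<open>c\<close>. The four
  conclusions correspond to the four possible places of these two edges in
  \<open>switch\<close>.\<close>

lemma card_filter_exchange:
  assumes "finite E" "a \<in> E" "c \<notin> E" "P a" "\<not> P b" "P c" "\<not> P d"
  shows "card {e \<in> (E - {a, b}) \<union> {c, d}. P e} = card {e \<in> E. P e}"
    and "card {e \<in> (E - {b, a}) \<union> {c, d}. P e} = card {e \<in> E. P e}"
    and "card {e \<in> (E - {a, b}) \<union> {d, c}. P e} = card {e \<in> E. P e}"
    and "card {e \<in> (E - {b, a}) \<union> {d, c}. P e} = card {e \<in> E. P e}"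
proof -
  have eq: "{e \<in> (E - {a, b}) \<union> {c, d}. P e} = insert c ({e \<in> E. P e} - {a})"
    using assms by auto
  have "card (insert c ({e \<in> E. P e} - {a})) = Suc (card ({e \<in> E. P e} - {a}))"
    using assms by (intro card_insert_disjoint) auto
  also have "\<dots> = card {e \<in> E. P e}" using assms by (intro card_Suc_Diff1) auto
  finally show "card {e \<in> (E - {a, b}) \<union> {c, d}. P e} = card {e \<in> E. P e}" by (simp only: eq)
  thus "card {e \<in> (E - {b, a}) \<union> {c, d}. P e} = card {e \<in> E. P e}"
    "card {e \<in> (E - {a, b}) \<union> {d, c}. P e} = card {e \<in> E. P e}"
    "card {e \<in> (E - {b, a}) \<union> {d, c}. P e} = card {e \<in> E. P e}"
    by (simp_all only: insert_commute)
qed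

lemma finite_graph: "finite L \<Longrightarrow> finite R \<Longrightarrow> E \<subseteq> bipartite_edges L R \<Longrightarrow> finite E"
  by (rule finite_subset[of _ "Pow (L \<union> R)"]) (auto simp: bipartite_edges_def)

lemma biregular_switch:
  assumes fin: "finite L" "finite R" and disj: "L \<inter> R = {}"
    and E: "biregular L R dL dR E"
    and uv: "u \<in> L" "v \<in> R" "u' \<in> L" "v' \<in> R"
    and mem: "{u, v} \<in> E" "{u', v'} \<in> E" and non: "{u, v'} \<notin> E" "{u', v} \<notin> E"
  shows "biregular L R dL dR (switch u v u' v' E)"
proof -
  have sub: "E \<subseteq> bipartite_edges L R" using E by (simp add: biregular_def)
  have finE: "finite E" using fin sub by (rule finite_graph)
  have ne: "u \<noteq> u'" "v \<noteq> v'" using mem non by auto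
  have LR: "a \<noteq> b" if "a \<in> L" "b \<in> R" for a b using that disj by auto
  have d: "u \<noteq> v" "u \<noteq> v'" "u' \<noteq> v" "u' \<noteq> v'" using LR uv by auto
  have deg: "vertex_degree (switch u v u' v' E) x = vertex_degree E x" for x
  proof -
    consider "x = u" | "x = v" | "x = u'" | "x = v'" | "x \<notin> {u, v, u', v'}" by blast
    thus ?thesis
    proof cases
      case 1
      thus ?thesis unfolding vertex_degree_def switch_def
        using finE mem non ne d by (intro card_filter_exchange(1)) auto
    next
      case 2
      thus ?thesis unfolding vertex_degree_def switch_def
        using finE mem non ne d by (intro card_filter_exchange(3)) auto
    next
      case 3
      thus ?thesis unfolding vertex_degree_def switch_def
        using finE mem non ne d by (intro card_filter_exchange(4)) auto
    next
      case 4
      thus ?thesis unfolding vertex_degree_def switch_def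
        using finE mem non ne d by (intro card_filter_exchange(2)) auto
    next
      case 5
      have "{e \<in> switch u v u' v' E. x \<in> e} = {e \<in> E. x \<in> e}"
        using 5 by (auto simp: switch_def)
      thus ?thesis by (simp add: vertex_degree_def)
    qed
  qed
  have "switch u v u' v' E \<subseteq> bipartite_edges L R"
    using sub bipartite_edges_iff[OF disj] uv by (auto simp: switch_def)
  thus ?thesis using E deg by (simp add: biregular_def)
qed

text \<open>A switching is undone by the switching with the roles of \<open>v\<close> and
  \<open>v'\<close> exchanged. This makes the double count below injective.\<close>

lemma switch_switch:
  assumes "{u, v} \<in> E" "{u', v'} \<in> E" "{u, v'} \<notin> E" "{u', v} \<notin> E"
  shows "switch u v' u' v (switch u v u' v' E) = E"
proof -
  have "(((E - {a, b}) \<union> {c, d}) - {c, d}) \<union> {a, b} = E"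
    if "a \<in> E" "b \<in> E" "c \<notin> E" "d \<notin> E" for a b c d
    using that by auto
  from this[OF assms] show ?thesis by (simp add: switch_def)
qed

section \<open>Neighbourhoods and degrees\<close>

lemma card_nbrs_eq_degree:
  assumes doubleton: "\<And>e. e \<in> E \<Longrightarrow> \<exists>a b. a \<noteq> b \<and> e = {a, b}"
  shows "card {w. {x, w} \<in> E} = vertex_degree E x"
proof -
  have "bij_betw (\<lambda>w. {x, w}) {w. {x, w} \<in> E} {e \<in> E. x \<in> e}"
    unfolding bij_betw_def
  proof
    show "inj_on (\<lambda>w. {x, w}) {w. {x, w} \<in> E}" by (auto simp: inj_on_def doubleton_eq_iff)
    show "(\<lambda>w. {x, w}) ` {w. {x, w} \<in> E} = {e \<in> E. x \<in> e}"
    proof (intro equalityI subsetI)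
      fix e assume "e \<in> {e \<in> E. x \<in> e}"
      hence e: "e \<in> E" "x \<in> e" by auto
      then obtain a b where ab: "e = {a, b}" using doubleton[of e] by auto
      hence "x = a \<or> x = b" using e by auto
      hence "\<exists>w. e = {x, w}" using ab by auto
      then obtain w where "e = {x, w}" ..
      thus "e \<in> (\<lambda>w. {x, w}) ` {w. {x, w} \<in> E}" using e by blast
    qed auto
  qed
  thus ?thesis by (simp add: vertex_degree_def bij_betw_same_card)
qed

lemma bipartite_edge_doubleton:
  assumes "L \<inter> R = {}" "E \<subseteq> bipartite_edges L R" "e \<in> E"
  shows "\<exists>a b. a \<noteq> b \<and> e = {a, b}"
proof -
  have "e \<in> bipartite_edges L R" using assms by blast
  then obtain u v where "e = {u, v}" "u \<in> L" "v \<in> R"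
    unfolding bipartite_edges_def by blast
  moreover from this have "u \<noteq> v" using assms(1) by auto
  ultimately show ?thesis by (intro exI[of _ u] exI[of _ v]) simp
qed

lemma bipartite_adjacent:
  assumes "L \<inter> R = {}" "E \<subseteq> bipartite_edges L R" "{x, w} \<in> E"
  shows "x \<in> L \<and> w \<in> R \<or> x \<in> R \<and> w \<in> L"
proof -
  have "{x, w} \<in> bipartite_edges L R" using assms by blast
  then obtain u v where "{x, w} = {u, v}" "u \<in> L" "v \<in> R"
    unfolding bipartite_edges_def by blast
  thus ?thesis by (auto simp: doubleton_eq_iff)
qed

lemma finite_nbrs:
  assumes "finite L" "finite R" "L \<inter> R = {}" "E \<subseteq> bipartite_edges L R"
  shows "finite {w. {x, w} \<in> E}"
proof (rule finite_subset)
  show "{w. {x, w} \<in> E} \<subseteq> L \<union> R" using bipartite_adjacent[OF assms(3,4)] by blast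
qed (use assms in simp)

lemma biregular_card_nbrs:
  assumes disj: "L \<inter> R = {}" and E: "biregular L R dL dR E"
  shows "x \<in> L \<Longrightarrow> card {w. {x, w} \<in> E} = dL" "x \<in> R \<Longrightarrow> card {w. {x, w} \<in> E} = dR"
proof -
  have "card {w. {x, w} \<in> E} = vertex_degree E x" for x
    using E by (intro card_nbrs_eq_degree bipartite_edge_doubleton[OF disj])
      (auto simp: biregular_def)
  thus "x \<in> L \<Longrightarrow> card {w. {x, w} \<in> E} = dL" "x \<in> R \<Longrightarrow> card {w. {x, w} \<in> E} = dR"
    using E by (simp_all add: biregular_def)
qed

text \<open>Edges oriented from \<open>L\<close> to \<open>R\<close>: a switching has to know which
  end of the second edge is which.\<close>

definition arcs :: "nat set \<Rightarrow> nat set \<Rightarrow> nat set set \<Rightarrow> (nat \<times> nat) set" where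
  "arcs L R E = {(a, b). a \<in> L \<and> b \<in> R \<and> {a, b} \<in> E}"

lemma finite_arcs: "finite L \<Longrightarrow> finite R \<Longrightarrow> finite (arcs L R E)"
  by (rule finite_subset[of _ "L \<times> R"]) (auto simp: arcs_def)

lemma card_arcs:
  assumes fin: "finite L" "finite R" and disj: "L \<inter> R = {}" and E: "biregular L R dL dR E"
  shows "card (arcs L R E) = card R * dR"
proof -
  have sub: "E \<subseteq> bipartite_edges L R" using E by (simp add: biregular_def)
  have "arcs L R E = prod.swap ` (SIGMA b:R. {a. {b, a} \<in> E})"
  proof (intro equalityI subsetI)
    fix p assume "p \<in> arcs L R E"
    then obtain a b where "p = (a, b)" "b \<in> R" "{b, a} \<in> E"
      by (auto simp: arcs_def insert_commute)
    thus "p \<in> prod.swap ` (SIGMA b:R. {a. {b, a} \<in> E})" by (intro image_eqI[of _ _ "(b, a)"]) auto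
  next
    fix p assume "p \<in> prod.swap ` (SIGMA b:R. {a. {b, a} \<in> E})"
    then obtain a b where p: "p = (a, b)" "b \<in> R" "{b, a} \<in> E" by auto
    moreover have "a \<in> L" using bipartite_adjacent[OF disj sub p(3)] p(2) disj by auto
    ultimately show "p \<in> arcs L R E" by (simp add: arcs_def insert_commute)
  qed
  hence "card (arcs L R E) = card (SIGMA b:R. {a. {b, a} \<in> E})"
    by (simp add: card_image)
  also have "\<dots> = (\<Sum>b\<in>R. card {a. {b, a} \<in> E})"
  proof (rule card_SigmaI)
    show "\<forall>b\<in>R. finite {a. {b, a} \<in> E}"
      using finite_nbrs[OF fin disj sub] by blast
  qed (rule fin)
  also have "\<dots> = card R * dR" using biregular_card_nbrs(2)[OF disj E] by simp
  finally show ?thesis .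
qed

text \<open>Double counting of the switchings that destroy the edge {u, v} and keep
  \<open>F\<close>. A graph containing both admits all of its arcs (u', v') except those in
  \<open>F\<close>, those with v' adjacent to u and those with u' adjacent to v. Conversely, in the
  switched graph v' is one of the \<open>dL\<close> neighbours of u and u' one of the
  \<open>dR\<close> neighbours of v, so at most \<open>dL * dR\<close> switchings lead to it. The
  subtraction is truncated, so the bound is informative only when \<open>card R * dR\<close>
  dominates.\<close>

lemma card_extending_edge_le:
  assumes fin: "finite L" "finite R" and disj: "L \<inter> R = {}"
    and finO: "finite {E. biregular L R dL dR E}"
    and uv: "u \<in> L" "v \<in> R" and F: "finite F" "{u, v} \<notin> F"
  shows "(card R * dR - card F - 2 * (dL * dR)) *
           card {E. biregular L R dL dR E \<and> insert {u, v} F \<subseteq> E}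
       \<le> dL * dR * card {E. biregular L R dL dR E \<and> F \<subseteq> E}"
proof -
  define S where "S = {E. biregular L R dL dR E \<and> insert {u, v} F \<subseteq> E}"
  define T where "T = {E. biregular L R dL dR E \<and> F \<subseteq> E}"
  have finS: "finite S" and finT: "finite T"
    using finO by (simp_all add: S_def T_def)
  have LR: "a \<noteq> b" if "a \<in> L" "b \<in> R" for a b using that disj by auto
  define good where "good E = {(u', v') \<in> arcs L R E. {u', v'} \<notin> F \<and>
    {u, v'} \<notin> E \<and> {u', v} \<notin> E}" for E
  define rev where "rev E = {v'. {u, v'} \<in> E} \<times> {u'. {v, u'} \<in> E}" for E
  have finN: "finite {w. {x, w} \<in> E}" if "biregular L R dL dR E" for x E
    using finite_nbrs[OF fin disj] that by (simp add: biregular_def)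
  have fing: "finite (good E)" for E
    by (rule finite_subset[OF _ finite_arcs[OF fin, of E]]) (auto simp: good_def)
  have lower: "card R * dR - card F - 2 * (dL * dR) \<le> card (good E)" if "E \<in> S" for E
  proof -
    have E: "biregular L R dL dR E" using that by (simp add: S_def)
    have sub: "E \<subseteq> bipartite_edges L R" using E by (simp add: biregular_def)
    \<comment> \<open>The arcs violating the three conditions in \<open>good\<close>.
      \<open>Y\<close> and \<open>Z\<close> count walks of length two from u and from v, hence have
      \<open>dL * dR\<close> elements each; the arc (u, v) itself falls under both.\<close>
    define X where "X = {(a, b) \<in> arcs L R E. {a, b} \<in> F}"
    define Y where "Y = (SIGMA b:{w. {u, w} \<in> E}. {a. {b, a} \<in> E})"
    define Z where "Z = (SIGMA a:{w. {v, w} \<in> E}. {b. {a, b} \<in> E})"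
    have "inj_on (\<lambda>(a, b). {a, b}) X"
      using LR by (force simp: inj_on_def X_def arcs_def doubleton_eq_iff)
    hence cX: "card X \<le> card F"
      by (rule card_inj_on_le) (use F in \<open>auto simp: X_def\<close>)
    have nb: "w \<in> R" if "{u, w} \<in> E" for w using bipartite_adjacent[OF disj sub that] uv LR by auto
    have nb': "w \<in> L" if "{v, w} \<in> E" for w using bipartite_adjacent[OF disj sub that] uv LR by auto
    have "card Y = (\<Sum>b\<in>{w. {u, w} \<in> E}. card {a. {b, a} \<in> E})"
      unfolding Y_def using finN[OF E] by (intro card_SigmaI) auto
    also have "\<dots> = (\<Sum>b\<in>{w. {u, w} \<in> E}. dR)"
      using nb biregular_card_nbrs(2)[OF disj E] by (intro sum.cong) auto
    finally have cY: "card Y = dL * dR" using biregular_card_nbrs(1)[OF disj E] uv by simp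
    have "card Z = (\<Sum>b\<in>{w. {v, w} \<in> E}. card {a. {b, a} \<in> E})"
      unfolding Z_def using finN[OF E] by (intro card_SigmaI) auto
    also have "\<dots> = (\<Sum>b\<in>{w. {v, w} \<in> E}. dL)"
      using nb' biregular_card_nbrs(1)[OF disj E] by (intro sum.cong) auto
    finally have cZ: "card Z = dL * dR" using biregular_card_nbrs(2)[OF disj E] uv by simp
    have "X \<subseteq> arcs L R E" by (auto simp: X_def)
    hence finXYZ: "finite X" "finite Y" "finite Z"
      using finN[OF E] finite_subset[OF _ finite_arcs[OF fin, of E]]
      by (auto simp: Y_def Z_def)
    have "arcs L R E \<subseteq> good E \<union> (X \<union> (prod.swap ` Y \<union> Z))"
      by (auto simp: good_def X_def Y_def Z_def arcs_def insert_commute image_iff)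
    hence "card (arcs L R E) \<le> card (good E \<union> (X \<union> (prod.swap ` Y \<union> Z)))"
      using fing finXYZ by (intro card_mono) auto
    also have "\<dots> \<le> card (good E) + (card X + (card (prod.swap ` Y) + card Z))"
      using card_Un_le le_trans add_left_mono by meson
    also have "card (prod.swap ` Y) = card Y" by (simp add: card_image)
    finally show ?thesis using card_arcs[OF fin disj E] cX cY cZ by simp
  qed
  have upper: "card (rev E) = dL * dR" if "E \<in> T" for E
  proof -
    have E: "biregular L R dL dR E" using that by (simp add: T_def)
    show ?thesis unfolding rev_def card_cartesian_product
      using biregular_card_nbrs[OF disj E] uv by simp
  qed
  have finr: "finite (rev E)" if "E \<in> T" for E
    using finN that by (auto simp: rev_def T_def)
  have "(card R * dR - card F - 2 * (dL * dR)) * card S \<le> (\<Sum>E\<in>S. card (good E))"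
    using sum_mono[of S "\<lambda>_. card R * dR - card F - 2 * (dL * dR)" "\<lambda>E. card (good E)"] lower
    by (simp add: mult.commute)
  also have "\<dots> = card (Sigma S good)" using finS fing by simp
  also have "\<dots> \<le> card (Sigma T rev)"
  proof (rule card_inj_on_le[where f = "\<lambda>(E, u', v'). (switch u v u' v' E, v', u')"])
    show "inj_on (\<lambda>(E, u', v'). (switch u v u' v' E, v', u')) (Sigma S good)"
    proof (rule inj_onI, clarsimp)
      fix E1 E2 a b assume *: "E1 \<in> S" "(a, b) \<in> good E1" "E2 \<in> S" "(a, b) \<in> good E2"
        "switch u v a b E1 = switch u v a b E2"
      have "switch u b a v (switch u v a b E) = E" if "E \<in> S" "(a, b) \<in> good E" for E
        using that by (intro switch_switch) (auto simp: S_def good_def arcs_def)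
      thus "E1 = E2" using * by metis
    qed
    show "(\<lambda>(E, u', v'). (switch u v u' v' E, v', u')) ` Sigma S good \<subseteq> Sigma T rev"
    proof clarsimp
      fix E a b assume *: "E \<in> S" "(a, b) \<in> good E"
      have "biregular L R dL dR (switch u v a b E)"
        using * uv by (intro biregular_switch[OF fin disj]) (auto simp: S_def good_def arcs_def)
      moreover have "F \<subseteq> switch u v a b E"
        using * F by (auto simp: S_def good_def switch_def)
      ultimately show "switch u v a b E \<in> T \<and> (b, a) \<in> rev (switch u v a b E)"
        by (auto simp: T_def rev_def switch_def insert_commute)
    qed
    show "finite (Sigma T rev)" using finT finr by simp
  qed
  also have "\<dots> = (\<Sum>E\<in>T. card (rev E))" using finT finr by simp
  also have "\<dots> = dL * dR * card T" using upper by simp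
  finally show ?thesis by (simp add: S_def T_def)
qed

text \<open>The edges of \<open>F\<close> are imposed one at a time. The hypothesis
  \<open>small\<close> keeps the factor on the left of \<open>card_extending_edge_le\<close> above n
  dR / 2, so each edge costs at most dL dR / (n dR / 2) = 2 dL / n; a set that is not an edge of the
  complete bipartite graph lies in no graph at all.\<close>

lemma card_biregular_containing_le:
  assumes fin: "finite F" and small: "2 * (card F + 2 * (dL * dR)) \<le> n * dR" and pos: "0 < n" "0 < dR"
  shows "real (card {E \<in> biregular_graphs m n dL dR. F \<subseteq> E})
       \<le> (2 * real dL / real n) ^ card F * real (card (biregular_graphs m n dL dR))"
  using fin small
proof (induction F)
  case empty
  show ?case by simp
next
  case (insert e F)
  let ?L = "{..<m}" and ?R = "{m..<m + n}"
  have B: "biregular_graphs m n dL dR = {E. biregular ?L ?R dL dR E}"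
    by (simp add: biregular_graphs_def)
  have disj: "?L \<inter> ?R = {}" by auto
  show ?case
  proof (cases "e \<in> bipartite_edges ?L ?R")
    case False
    hence "{E \<in> biregular_graphs m n dL dR. insert e F \<subseteq> E} = {}"
      by (auto simp: B biregular_def)
    thus ?thesis by (simp only: card.empty) simp
  next
    case True
    then obtain u v where uv: "e = {u, v}" "u \<in> ?L" "v \<in> ?R" by (auto simp: bipartite_edges_def)
    define a where "a = real (card {E \<in> biregular_graphs m n dL dR. insert e F \<subseteq> E})"
    define b where "b = real (card {E \<in> biregular_graphs m n dL dR. F \<subseteq> E})"
    have IH: "b \<le> (2 * real dL / real n) ^ card F * real (card (biregular_graphs m n dL dR))"
      unfolding b_def using insert by (intro insert.IH) auto
    have "(n * dR - card F - 2 * (dL * dR)) * card {E \<in> biregular_graphs m n dL dR. insert e F \<subseteq> E}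
        \<le> dL * dR * card {E \<in> biregular_graphs m n dL dR. F \<subseteq> E}"
      using card_extending_edge_le[OF _ _ disj _ uv(2,3), of dL dR F] insert.hyps uv
        finite_biregular_graphs[of m n dL dR] by (simp add: B)
    hence "real (n * dR - card F - 2 * (dL * dR)) * a \<le> real (dL * dR) * b"
      unfolding a_def b_def using of_nat_mono[where 'a = real] by fastforce
    moreover have "n * dR \<le> 2 * (n * dR - card F - 2 * (dL * dR))"
      using insert.prems insert.hyps by simp
    hence "real (n * dR) \<le> real (2 * (n * dR - card F - 2 * (dL * dR)))" by (simp only: of_nat_le_iff)
    hence "real (n * dR) / 2 \<le> real (n * dR - card F - 2 * (dL * dR))" by simp
    hence "real (n * dR) / 2 * a \<le> real (n * dR - card F - 2 * (dL * dR)) * a"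
      by (intro mult_right_mono) (simp_all add: a_def)
    ultimately have "real (n * dR) / 2 * a \<le> real (dL * dR) * b" by linarith
    hence "real n * a \<le> 2 * real dL * b" using pos by simp
    hence "a \<le> (2 * real dL / real n) * b" using pos by (simp add: field_simps)
    also have "\<dots> \<le> (2 * real dL / real n) * ((2 * real dL / real n) ^ card F * real (card (biregular_graphs m n dL dR)))"
      by (intro mult_left_mono IH) auto
    finally show ?thesis using insert.hyps by (simp add: a_def mult_ac)
  qed
qed

subsection \<open>Short cycles\<close>

definition cyc_edges :: "nat list \<Rightarrow> nat set set" where
  "cyc_edges xs = (\<lambda>t. {xs ! t, xs ! (Suc t mod length xs)}) ` {..<length xs}"

text \<open>Rooted and oriented cycles as vertex lists: for c at least 3 each cycle is counted 2 c
  times, which does no harm in upper bounds, and pairs of cycles become lists by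
  concatenation.\<close>

definition cycles :: "nat set \<Rightarrow> nat \<Rightarrow> nat set set \<Rightarrow> nat list set" where
  "cycles V c E = {xs. set xs \<subseteq> V \<and> length xs = c \<and> distinct xs \<and> cyc_edges xs \<subseteq> E}"

lemma finite_cyc_edges: "finite (cyc_edges xs)"
  by (simp add: cyc_edges_def)

lemma card_cyc_edges_le: "card (cyc_edges xs) \<le> length xs"
  unfolding cyc_edges_def using card_image_le[of "{..<length xs}"] by fastforce

lemma finite_cycles: "finite V \<Longrightarrow> finite (cycles V c E)"
  by (rule finite_subset[OF _ finite_lists_length_eq[of V c]]) (auto simp: cycles_def)

text \<open>Two positions with the same edge would have to be successors of each other modulo the
  length, which happens only for length 2, where the single edge is traversed twice.\<close>

lemma inj_cyc_edges:
  assumes d: "distinct xs" and l: "3 \<le> length xs"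
  shows "inj_on (\<lambda>t. {xs ! t, xs ! (Suc t mod length xs)}) {..<length xs}"
proof (rule inj_onI)
  let ?c = "length xs"
  fix t u assume tu: "t \<in> {..<?c}" "u \<in> {..<?c}"
    and eq: "{xs ! t, xs ! (Suc t mod ?c)} = {xs ! u, xs ! (Suc u mod ?c)}"
  have c: "Suc t mod ?c < ?c" "Suc u mod ?c < ?c" using l by (auto intro!: mod_less_divisor)
  show "t = u"
  proof (rule ccontr)
    assume ne: "t \<noteq> u"
    hence "xs ! t \<noteq> xs ! u" using tu d by (simp add: nth_eq_iff_index_eq)
    hence "xs ! t = xs ! (Suc u mod ?c)" "xs ! u = xs ! (Suc t mod ?c)"
      using eq by (auto simp: doubleton_eq_iff)
    hence "t = Suc u mod ?c" "u = Suc t mod ?c"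
      using tu d c by (simp_all add: nth_eq_iff_index_eq)
    moreover have "t mod ?c = t" "u mod ?c = u" using tu by simp_all
    ultimately show False using l by (simp add: mod_Suc split: if_splits)
  qed
qed

text \<open>Each vertex of a cycle is charged to the edge leaving it; for the second cycle only the
  vertices off the first cycle are charged, and their edges are not edges of the first cycle.\<close>

lemma card_two_cycles_le:
  assumes xs: "distinct xs" "3 \<le> length xs" and ys: "distinct ys" "3 \<le> length ys"
  shows "card (set xs \<union> set ys) \<le> card (cyc_edges xs \<union> cyc_edges ys)"
proof -
  let ?f = "\<lambda>t. {ys ! t, ys ! (Suc t mod length ys)}"
  define T where "T = {t. t < length ys \<and> ys ! t \<notin> set xs}"
  have "set ys - set xs = (!) ys ` T" by (auto simp: T_def in_set_conv_nth)
  moreover have "inj_on ((!) ys) T"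
    using ys by (auto simp: inj_on_def T_def nth_eq_iff_index_eq)
  ultimately have "card (set ys - set xs) = card T" by (simp add: card_image)
  also have "\<dots> = card (?f ` T)"
    using inj_on_subset[OF inj_cyc_edges[OF ys], of T]
    by (subst card_image) (auto simp: T_def)
  finally have 1: "card (set ys - set xs) = card (?f ` T)" .
  have 2: "card (set xs) = card (cyc_edges xs)"
    using inj_cyc_edges[OF xs] xs by (simp add: cyc_edges_def card_image distinct_card)
  have sub: "e \<subseteq> set xs" if e: "e \<in> cyc_edges xs" for e
  proof -
    obtain t where "t < length xs" "e = {xs ! t, xs ! (Suc t mod length xs)}"
      using e unfolding cyc_edges_def by blast
    moreover have "Suc t mod length xs < length xs" using xs by (intro mod_less_divisor) auto
    ultimately show ?thesis by auto
  qed
  hence disj: "cyc_edges xs \<inter> ?f ` T = {}" by (auto simp: T_def)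
  have finT: "finite T" by (simp add: T_def)
  have "card (set xs \<union> set ys) = card (set xs) + card (set ys - set xs)"
    by (subst card_Un_disjoint[symmetric]) auto
  also have "\<dots> = card (cyc_edges xs \<union> ?f ` T)"
    using disj finT by (simp only: 1 2 card_Un_disjoint finite_cyc_edges finite_imageI)
  also have "\<dots> \<le> card (cyc_edges xs \<union> cyc_edges ys)"
    by (rule card_mono) (auto simp: finite_cyc_edges cyc_edges_def T_def)
  finally show ?thesis .
qed

text \<open>A new letter either repeats one of at most \<open>k\<close> earlier ones, at no cost, or is one of at
  most \<open>card V\<close> fresh ones, each of which costs a factor \<open>1 / card V\<close>.\<close>

lemma sum_lists_inverse_card_le:
  assumes fin: "finite V" and ne: "V \<noteq> {}"
  shows "(\<Sum>xs | set xs \<subseteq> V \<and> length xs = k. (1 / real (card V)) ^ card (set xs)) \<le> fact k"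
proof (induction k)
  case 0
  have "{xs. set xs \<subseteq> V \<and> length xs = 0} = {[]}" by auto
  thus ?case by simp
next
  case (Suc k)
  let ?L = "\<lambda>k. {xs. set xs \<subseteq> V \<and> length xs = k}"
  let ?N = "real (card V)"
  have N: "?N > 0" using fin ne by (simp add: card_gt_0_iff)
  have "?L (Suc k) = (\<lambda>(xs, v). v # xs) ` (?L k \<times> V)"
    by (auto simp: image_iff length_Suc_conv)
  hence "(\<Sum>xs\<in>?L (Suc k). (1 / ?N) ^ card (set xs))
      = (\<Sum>(xs, v)\<in>?L k \<times> V. (1 / ?N) ^ card (insert v (set xs)))"
    by (simp add: sum.reindex inj_on_def case_prod_unfold)
  also have "\<dots> = (\<Sum>xs\<in>?L k. \<Sum>v\<in>V. (1 / ?N) ^ card (insert v (set xs)))"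
    using fin by (simp add: sum.cartesian_product)
  also have "\<dots> \<le> (\<Sum>xs\<in>?L k. real (Suc k) * (1 / ?N) ^ card (set xs))"
  proof (rule sum_mono)
    fix xs assume xs: "xs \<in> ?L k"
    let ?w = "(1 / ?N) ^ card (set xs)"
    have w: "0 \<le> ?w / ?N" "0 \<le> ?w" by simp_all
    have "(\<Sum>v\<in>V. (1 / ?N) ^ card (insert v (set xs)))
        = (\<Sum>v\<in>V. if v \<in> set xs then ?w else ?w / ?N)"
      by (intro sum.cong) (simp_all add: insert_absorb)
    also have "\<dots> \<le> (\<Sum>v\<in>V. (if v \<in> set xs then ?w else 0) + ?w / ?N)"
      using w by (intro sum_mono) (simp del: power_one_over)
    also have "\<dots> = real (card (V \<inter> set xs)) * ?w + ?w"
      using N fin ne by (simp add: sum.distrib flip: sum.inter_restrict)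
    also have "\<dots> \<le> real k * ?w + ?w"
    proof (intro add_right_mono mult_right_mono)
      have "card (V \<inter> set xs) \<le> card (set xs)" by (intro card_mono) auto
      also have "\<dots> \<le> k" using card_length[of xs] xs by simp
      finally show "real (card (V \<inter> set xs)) \<le> real k" by simp
    qed simp
    finally show "(\<Sum>v\<in>V. (1 / ?N) ^ card (insert v (set xs))) \<le> real (Suc k) * ?w"
      by (simp add: algebra_simps)
  qed
  also have "\<dots> \<le> real (Suc k) * fact k"
    using Suc by (simp flip: sum_distrib_left)
  finally show ?case by simp
qed

text \<open>The square counts pairs of cycles. A pair on w vertices has at least w edges, so as
  \<open>q\<close> is at most 1 it occurs with probability at most q^w, which is at most Q^(2c) / (m
  + n)^w. The denominator compensates the choices of the w vertices, and
  \<open>sum_lists_inverse_card_le\<close>, applied to the concatenated lists, leaves only a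
  factorial.\<close>

lemma sum_card_cycles_squared_le:
  fixes m n dL dR c :: nat
  defines "\<Omega> \<equiv> biregular_graphs m n dL dR" and "V \<equiv> {..<m + n}"
  defines "q \<equiv> 2 * real dL / real n"
  assumes c: "3 \<le> c" and small: "2 * (2 * c + 2 * (dL * dR)) \<le> n * dR" and pos: "0 < n" "0 < dR"
    and q: "q \<le> 1" and Q: "q * real (m + n) \<le> Q" "1 \<le> Q"
  shows "(\<Sum>E\<in>\<Omega>. (real (card (cycles V c E)))\<^sup>2) \<le> Q ^ (2 * c) * fact (2 * c) * real (card \<Omega>)"
proof -
  have fin: "finite \<Omega>" unfolding \<Omega>_def by (rule finite_biregular_graphs)
  have finV: "finite V" "V \<noteq> {}" and cV: "card V = m + n" using pos by (auto simp: V_def)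
  define C where "C = {xs. set xs \<subseteq> V \<and> length xs = c \<and> distinct xs}"
  have finC: "finite C"
    by (rule finite_subset[OF _ finite_lists_length_eq[OF finV(1), of c]]) (auto simp: C_def)
  have q0: "0 \<le> q" by (simp add: q_def)
  have cy: "real (card (cycles V c E)) = (\<Sum>xs\<in>C. if cyc_edges xs \<subseteq> E then 1 else 0)" for E
  proof -
    have "cycles V c E = {xs \<in> C. cyc_edges xs \<subseteq> E}" by (auto simp: cycles_def C_def)
    thus ?thesis using finC by (simp add: sum.If_cases Int_def conj_commute)
  qed
  have "(\<Sum>E\<in>\<Omega>. (real (card (cycles V c E)))\<^sup>2)
      = (\<Sum>E\<in>\<Omega>. \<Sum>xs\<in>C. \<Sum>ys\<in>C. if cyc_edges xs \<union> cyc_edges ys \<subseteq> E then 1 else 0)"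
    unfolding cy power2_eq_square sum_product by (intro sum.cong refl) auto
  also have "\<dots> = (\<Sum>xs\<in>C. \<Sum>ys\<in>C. \<Sum>E\<in>\<Omega>. if cyc_edges xs \<union> cyc_edges ys \<subseteq> E then 1 else 0)"
    by (subst sum.swap, rule sum.cong[OF refl], rule sum.swap)
  also have "\<dots> \<le> (\<Sum>xs\<in>C. \<Sum>ys\<in>C.
      Q ^ (2 * c) * real (card \<Omega>) * (1 / real (card V)) ^ card (set (xs @ ys)))"
  proof (intro sum_mono)
    fix xs ys assume "xs \<in> C" "ys \<in> C"
    hence xs: "set xs \<subseteq> V" "length xs = c" "distinct xs"
      and ys: "set ys \<subseteq> V" "length ys = c" "distinct ys" by (auto simp: C_def)
    define F where "F = cyc_edges xs \<union> cyc_edges ys"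
    let ?w = "card (set (xs @ ys))"
    have cF: "card F \<le> 2 * c"
      using card_Un_le[of "cyc_edges xs" "cyc_edges ys"] card_cyc_edges_le[of xs]
        card_cyc_edges_le[of ys] xs ys by (simp add: F_def)
    have wF: "?w \<le> card F"
      using card_two_cycles_le[of xs ys] xs ys c by (simp add: F_def)
    have w: "?w \<le> 2 * c" using card_length[of "xs @ ys"] xs ys by simp
    have "(\<Sum>E\<in>\<Omega>. if F \<subseteq> E then 1 else 0) = real (card {E \<in> \<Omega>. F \<subseteq> E})"
      using fin by (simp add: sum.If_cases Int_def conj_commute)
    also have "\<dots> \<le> q ^ card F * real (card \<Omega>)"
      unfolding \<Omega>_def q_def using cF small pos
      by (intro card_biregular_containing_le) (auto simp: F_def finite_cyc_edges)
    also have "\<dots> \<le> q ^ ?w * real (card \<Omega>)"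
      using q q0 wF by (intro mult_right_mono power_decreasing) auto
    also have "q ^ ?w = (q * real (m + n)) ^ ?w * (1 / real (card V)) ^ ?w"
      using pos by (simp add: cV flip: power_mult_distrib)
    also have "\<dots> \<le> Q ^ (2 * c) * (1 / real (card V)) ^ ?w"
    proof (intro mult_right_mono)
      have "(q * real (m + n)) ^ ?w \<le> Q ^ ?w" using Q q0 by (intro power_mono) auto
      also have "\<dots> \<le> Q ^ (2 * c)" using Q w by (intro power_increasing) auto
      finally show "(q * real (m + n)) ^ ?w \<le> Q ^ (2 * c)" .
    qed simp
    finally show "(\<Sum>E\<in>\<Omega>. if F \<subseteq> E then 1 else 0)
        \<le> Q ^ (2 * c) * real (card \<Omega>) * (1 / real (card V)) ^ ?w"
      by (simp add: mult_ac mult_left_mono mult_right_mono)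
  qed
  also have "\<dots> = Q ^ (2 * c) * real (card \<Omega>) *
      (\<Sum>(xs, ys)\<in>C \<times> C. (1 / real (card V)) ^ card (set (xs @ ys)))"
    using finC by (simp add: sum.cartesian_product sum_distrib_left case_prod_unfold)
  also have "(\<Sum>(xs, ys)\<in>C \<times> C. (1 / real (card V)) ^ card (set (xs @ ys)))
      = (\<Sum>zs\<in>(\<lambda>(xs, ys). xs @ ys) ` (C \<times> C). (1 / real (card V)) ^ card (set zs))"
    by (subst sum.reindex) (auto simp: inj_on_def C_def case_prod_unfold)
  also have "\<dots> \<le> (\<Sum>zs | set zs \<subseteq> V \<and> length zs = 2 * c. (1 / real (card V)) ^ card (set zs))"
    using finV by (intro sum_mono2 finite_lists_length_eq) (auto simp: C_def)
  also have "\<dots> \<le> fact (2 * c)" by (rule sum_lists_inverse_card_le[OF finV])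
  finally show ?thesis using Q by (simp add: mult_ac mult_left_mono mult_right_mono)
qed

text \<open>Chebyshev's inequality with \<open>Q = 4 * dR\<close>: by m dL = n dR the expected
  degree scale q (m + n) equals 2 (dR + dL). The hypothesis \<open>small\<close> contains 4 dL \<le>
  n, which gives \<open>q \<le> 1\<close>.\<close>

lemma card_many_cycles_le:
  fixes m n dL dR c :: nat and \<tau> :: real
  defines "\<Omega> \<equiv> biregular_graphs m n dL dR" and "V \<equiv> {..<m + n}"
  assumes c: "3 \<le> c" and bal: "m * dL = n * dR" and le: "dL \<le> dR" and pos: "0 < n" "0 < dR" "0 < \<tau>"
    and small: "4 * c + 4 * (dL * dR) \<le> n * dR"
  shows "real (card {E \<in> \<Omega>. \<tau> \<le> real (card (cycles V c E))})
       \<le> (4 * real dR) ^ (2 * c) * fact (2 * c) / \<tau>\<^sup>2 * real (card \<Omega>)"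
proof -
  have fin: "finite \<Omega>" unfolding \<Omega>_def by (rule finite_biregular_graphs)
  have "(4 * dL) * dR \<le> n * dR" unfolding mult.assoc using small by linarith
  hence "4 * dL \<le> n" using pos by (simp only: mult_le_cancel2)
  hence q: "2 * real dL / real n \<le> 1" using pos by (simp add: field_simps)
  have "real dL * real m = real dR * real n" using bal by (metis mult.commute of_nat_mult)
  hence "2 * real dL / real n * real (m + n) = 2 * (real dR + real dL)"
    using pos by (simp add: field_simps)
  also have "\<dots> \<le> 4 * real dR" using le by simp
  finally have Q: "2 * real dL / real n * real (m + n) \<le> 4 * real dR" .
  have sec: "(\<Sum>E\<in>\<Omega>. (real (card (cycles V c E)))\<^sup>2)
      \<le> (4 * real dR) ^ (2 * c) * fact (2 * c) * real (card \<Omega>)"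
    unfolding \<Omega>_def V_def
    by (rule sum_card_cycles_squared_le) (use c small pos q Q in auto)
  let ?B = "{E \<in> \<Omega>. \<tau> \<le> real (card (cycles V c E))}"
  have "real (card ?B) * \<tau>\<^sup>2 = (\<Sum>E\<in>?B. \<tau>\<^sup>2)" by simp
  also have "\<dots> \<le> (\<Sum>E\<in>?B. (real (card (cycles V c E)))\<^sup>2)"
    using pos by (intro sum_mono power_mono) auto
  also have "\<dots> \<le> (\<Sum>E\<in>\<Omega>. (real (card (cycles V c E)))\<^sup>2)"
    using fin by (intro sum_mono2) auto
  finally have "real (card ?B) * \<tau>\<^sup>2 \<le> (4 * real dR) ^ (2 * c) * fact (2 * c) * real (card \<Omega>)"
    using sec by linarith
  thus ?thesis using pos by (simp add: field_simps)
qed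

subsection \<open>Jacobi recursions\<close>

text \<open>The coefficients of x^j in a basis of monic polynomials with x p_s = p_(s+1) + B_s
  p_(s-1). Equivalently, the weighted number of paths from height 0 to height s with j steps up or
  down that stay nonnegative, a step down from height t having weight \<open>B t\<close>. At s = 0
  this is the j-th moment of the normalised orthogonality measure.\<close>

fun jacobi_coeff :: "(nat \<Rightarrow> real) \<Rightarrow> nat \<Rightarrow> nat \<Rightarrow> real" where
  "jacobi_coeff B 0 s = (if s = 0 then 1 else 0)"
| "jacobi_coeff B (Suc j) s =
     (if s = 0 then 0 else jacobi_coeff B j (s - 1)) + B (Suc s) * jacobi_coeff B j (Suc s)"

lemma jacobi_coeff_eq_0: "j < s \<Longrightarrow> jacobi_coeff B j s = 0"
  by (induction j arbitrary: s) auto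

lemma tendsto_jacobi_coeff:
  assumes "\<And>s. ((\<lambda>k. B k s) \<longlongrightarrow> C s) F"
  shows "((\<lambda>k. jacobi_coeff (B k) j s) \<longlongrightarrow> jacobi_coeff C j s) F"
  by (induction j arbitrary: s) (auto intro!: tendsto_intros assms)

text \<open>The index type is arbitrary because the expansion below is used twice: for the adjacency
  kernel, and on a one-point set, where the kernel is multiplication by a real number.\<close>

definition kernel_apply :: "'a set \<Rightarrow> ('a \<Rightarrow> 'a \<Rightarrow> real) \<Rightarrow> ('a \<Rightarrow> real) \<Rightarrow> 'a \<Rightarrow> real" where
  "kernel_apply V K f x = (\<Sum>z\<in>V. K x z * f z)"

lemma jacobi_expansion:
  assumes p0: "\<And>x. x \<in> V \<Longrightarrow> kernel_apply V K (p 0) x = p (Suc 0) x"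
    and pS: "\<And>s x. x \<in> V \<Longrightarrow>
       kernel_apply V K (p (Suc s)) x = p (Suc (Suc s)) x + B (Suc s) * p s x"
  shows "x \<in> V \<Longrightarrow> (kernel_apply V K ^^ j) (p 0) x = (\<Sum>s\<le>j. jacobi_coeff B j s * p s x)"
proof (induction j arbitrary: x)
  case (Suc j)
  let ?c = "jacobi_coeff B j"
  have "(kernel_apply V K ^^ Suc j) (p 0) x
      = (\<Sum>z\<in>V. K x z * (\<Sum>s\<le>j. ?c s * p s z))"
  proof -
    have "(kernel_apply V K ^^ Suc j) (p 0) x = (\<Sum>z\<in>V. K x z * (kernel_apply V K ^^ j) (p 0) z)"
      by (simp add: kernel_apply_def)
    thus ?thesis using Suc.IH by simp
  qed
  also have "\<dots> = (\<Sum>s\<le>j. ?c s * kernel_apply V K (p s) x)"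
    unfolding kernel_apply_def sum_distrib_left
    by (subst sum.swap) (simp add: mult_ac)
  \<comment> \<open>Padding with the vanishing coefficient at \<open>Suc j\<close> lets the term s =
    0, which obeys its own recursion, be split off while the remaining sum still runs up to
    j.\<close>
  also have "\<dots> = (\<Sum>s\<le>Suc j. ?c s * kernel_apply V K (p s) x)"
    by (simp add: jacobi_coeff_eq_0)
  also have "\<dots> = ?c 0 * p (Suc 0) x
      + (\<Sum>s\<le>j. ?c (Suc s) * (p (Suc (Suc s)) x + B (Suc s) * p s x))"
    unfolding sum.atMost_Suc_shift by (simp add: p0[OF Suc.prems] pS[OF Suc.prems])
  also have "\<dots> = (?c 0 * p (Suc 0) x + (\<Sum>s\<le>j. ?c (Suc s) * p (Suc (Suc s)) x))
      + (\<Sum>s\<le>j. B (Suc s) * ?c (Suc s) * p s x)"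
    by (simp add: algebra_simps sum.distrib)
  also have "?c 0 * p (Suc 0) x + (\<Sum>s\<le>j. ?c (Suc s) * p (Suc (Suc s)) x)
      = (\<Sum>s\<le>Suc j. ?c s * p (Suc s) x)"
    unfolding sum.atMost_Suc_shift ..
  also have "\<dots> = (\<Sum>s\<le>j. ?c s * p (Suc s) x)"
    by (simp add: jacobi_coeff_eq_0)
  also have "\<dots> = (\<Sum>s\<le>Suc j. (if s = 0 then 0 else ?c (s - 1)) * p s x)"
    unfolding sum.atMost_Suc_shift by simp
  also have "(\<Sum>s\<le>j. B (Suc s) * ?c (Suc s) * p s x)
      = (\<Sum>s\<le>Suc j. B (Suc s) * ?c (Suc s) * p s x)"
    by (simp add: jacobi_coeff_eq_0)
  finally show ?case by (simp only: jacobi_coeff.simps distrib_right sum.distrib)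
qed simp

subsection \<open>Non-backtracking walks\<close>

definition nbrs :: "nat set set \<Rightarrow> nat \<Rightarrow> nat set" where
  "nbrs E x = {w. {x, w} \<in> E}"

lemma nbrs_sym: "x \<in> nbrs E y \<longleftrightarrow> y \<in> nbrs E x"
  by (simp add: nbrs_def insert_commute)

text \<open>\<open>nb_arcs E v0 s w v\<close> counts the non-backtracking walks of length \<open>s + 1\<close> from \<open>v0\<close> whose
  last step goes from \<open>w\<close> to \<open>v\<close>.\<close>

fun nb_arcs :: "nat set set \<Rightarrow> nat \<Rightarrow> nat \<Rightarrow> nat \<Rightarrow> nat \<Rightarrow> real" where
  "nb_arcs E v0 0 w v = (if w = v0 \<and> v \<in> nbrs E w then 1 else 0)"
| "nb_arcs E v0 (Suc s) w v =
     (if v \<in> nbrs E w then \<Sum>u\<in>nbrs E w - {v}. nb_arcs E v0 s u w else 0)"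

fun nb_walks :: "nat set set \<Rightarrow> nat \<Rightarrow> nat \<Rightarrow> nat \<Rightarrow> real" where
  "nb_walks E v0 0 x = (if x = v0 then 1 else 0)"
| "nb_walks E v0 (Suc s) x = (\<Sum>w\<in>nbrs E x. nb_arcs E v0 s w x)"

lemma nb_arcs_nonneg: "0 \<le> nb_arcs E v0 s w v"
  by (induction s arbitrary: w v) (auto intro: sum_nonneg)

lemma nb_walks_nonneg: "0 \<le> nb_walks E v0 s x"
  by (cases s) (auto intro: sum_nonneg nb_arcs_nonneg)

lemma nb_arcs_le:
  assumes "\<And>x. card (nbrs E x) \<le> d"
    and "\<And>x. finite (nbrs E x)"
  shows "nb_arcs E v0 s w v \<le> real d ^ s"
proof (induction s arbitrary: w v)
  case (Suc s)
  have "(\<Sum>u\<in>nbrs E w - {v}. nb_arcs E v0 s u w) \<le> real (card (nbrs E w - {v})) * real d ^ s"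
    using sum_bounded_above[of "nbrs E w - {v}" "\<lambda>u. nb_arcs E v0 s u w" "real d ^ s"] Suc by simp
  also have "\<dots> \<le> real d * real d ^ s"
    using order_trans[OF card_mono[of "nbrs E w" "nbrs E w - {v}"] assms(1)] assms(2)
    by (intro mult_right_mono) auto
  finally show ?case by simp
qed simp

lemma nb_walks_le:
  assumes "\<And>x. card (nbrs E x) \<le> d" and "\<And>x. finite (nbrs E x)"
  shows "nb_walks E v0 s x \<le> real d ^ s"
proof (cases s)
  case (Suc t)
  have "nb_walks E v0 s x \<le> real (card (nbrs E x)) * real d ^ t"
    using sum_bounded_above[of "nbrs E x" "\<lambda>u. nb_arcs E v0 t u x" "real d ^ t"]
      nb_arcs_le[of E d, OF assms] Suc by simp
  also have "\<dots> \<le> real d * real d ^ t" using assms by (intro mult_right_mono) auto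
  finally show ?thesis by (simp add: Suc)
qed simp

lemma nb_walks_0_step: 
  assumes "finite (nbrs E x)"
  shows "(\<Sum>v\<in>nbrs E x. nb_walks E v0 0 v) = nb_walks E v0 (Suc 0) x"
  by (auto simp: nbrs_sym intro!: sum.cong)

text \<open>A walk ending at a neighbour v of x, prolonged by the step to x, is either again
  non-backtracking or has just come from x; the second sum counts the latter.\<close>

lemma nb_walks_Suc_step:
  assumes fin: "\<And>x. finite (nbrs E x)"
  shows "(\<Sum>v\<in>nbrs E x. nb_walks E v0 (Suc s) v)
    = nb_walks E v0 (Suc (Suc s)) x + (\<Sum>v\<in>nbrs E x. nb_arcs E v0 s x v)"
proof -
  have "(\<Sum>v\<in>nbrs E x. nb_walks E v0 (Suc s) v)
      = (\<Sum>v\<in>nbrs E x. nb_arcs E v0 (Suc s) v x + nb_arcs E v0 s x v)"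
  proof (rule sum.cong[OF refl])
    fix v assume v: "v \<in> nbrs E x"
    hence "x \<in> nbrs E v" by (simp add: nbrs_sym)
    thus "nb_walks E v0 (Suc s) v = nb_arcs E v0 (Suc s) v x + nb_arcs E v0 s x v"
      using sum.remove[OF fin, of x v "\<lambda>w. nb_arcs E v0 s w v"] by simp
  qed
  thus ?thesis by (simp add: sum.distrib)
qed

text \<open>The start may be left towards every neighbour, whereas a longer walk must avoid its
  previous vertex. Hence the full degree here, the degree minus one in the next lemma, and the
  exceptional first coefficient in \<open>walk_coeff\<close>.\<close>

lemma nb_arcs_0_back:
  "(\<Sum>v\<in>nbrs E x. nb_arcs E v0 0 x v) = real (card (nbrs E x)) * nb_walks E v0 0 x"
  by simp

lemma nb_arcs_Suc_back:
  assumes fin: "finite (nbrs E x)"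
  shows "(\<Sum>v\<in>nbrs E x. nb_arcs E v0 (Suc s) x v)
    = (real (card (nbrs E x)) - 1) * nb_walks E v0 (Suc s) x"
proof -
  let ?f = "\<lambda>u. nb_arcs E v0 s u x"
  have "(\<Sum>v\<in>nbrs E x. nb_arcs E v0 (Suc s) x v) = (\<Sum>v\<in>nbrs E x. (\<Sum>u\<in>nbrs E x. ?f u) - ?f v)"
    using fin by (intro sum.cong) (simp_all add: sum_diff1)
  also have "\<dots> = (real (card (nbrs E x)) - 1) * (\<Sum>u\<in>nbrs E x. ?f u)"
    by (simp add: sum_subtractf algebra_simps)
  finally show ?thesis by simp
qed

section \<open>From closed non-backtracking walks to cycles\<close>

lemma nb_arcs_walk:
  "nb_arcs E v0 s w v \<noteq> 0 \<Longrightarrow> \<exists>x. x 0 = v0 \<and> x s = w \<and> x (Suc s) = v \<and>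
     (\<forall>i\<le>s. x (Suc i) \<in> nbrs E (x i)) \<and> (\<forall>i<s. x i \<noteq> x (Suc (Suc i)))"
proof (induction s arbitrary: w v)
  case 0
  hence "w = v0" "v \<in> nbrs E w" by (auto split: if_splits)
  thus ?case by (intro exI[of _ "\<lambda>i. if i = 0 then v0 else v"]) auto
next
  case (Suc s)
  hence v: "v \<in> nbrs E w" by (auto split: if_splits)
  with Suc.prems obtain u where u: "u \<noteq> v" "nb_arcs E v0 s u w \<noteq> 0"
    by (auto elim!: sum.not_neutral_contains_not_neutral)
  from Suc.IH[OF u(2)] obtain x where x: "x 0 = v0" "x s = u" "x (Suc s) = w"
    "\<forall>i\<le>s. x (Suc i) \<in> nbrs E (x i)" "\<forall>i<s. x i \<noteq> x (Suc (Suc i))" by blast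
  define x' where "x' = x(Suc (Suc s) := v)"
  have "x' (Suc i) \<in> nbrs E (x' i)" if "i \<le> Suc s" for i
    using that x v by (cases "i = Suc s") (auto simp: x'_def)
  moreover have "x' i \<noteq> x' (Suc (Suc i))" if "i < Suc s" for i
    using that x u by (cases "i = s") (auto simp: x'_def)
  ultimately show ?case using x by (intro exI[of _ x']) (auto simp: x'_def)
qed

fun walk_ends :: "nat set set \<Rightarrow> nat \<Rightarrow> nat \<Rightarrow> nat set" where
  "walk_ends E 0 z = {z}"
| "walk_ends E (Suc i) z = (\<Union>w\<in>walk_ends E i z. nbrs E w)"

lemma finite_card_walk_ends:
  assumes "\<And>x. card (nbrs E x) \<le> d" and "\<And>x. finite (nbrs E x)"
  shows "finite (walk_ends E i z) \<and> card (walk_ends E i z) \<le> d ^ i"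
proof (induction i)
  case (Suc i)
  have "card (walk_ends E (Suc i) z) \<le> (\<Sum>w\<in>walk_ends E i z. card (nbrs E w))"
    using Suc by (auto intro: card_UN_le)
  also have "\<dots> \<le> card (walk_ends E i z) * d"
    using sum_bounded_above[of "walk_ends E i z" "\<lambda>w. card (nbrs E w)" d] assms by simp
  also have "\<dots> \<le> d ^ i * d" using Suc by simp
  finally show ?case using Suc assms by (simp add: mult.commute)
qed simp

lemma walk_in_walk_ends:
  assumes "\<And>i. i < l \<Longrightarrow> x (Suc i) \<in> nbrs E (x i)"
  shows "k \<le> l \<Longrightarrow> x (l - k) \<in> walk_ends E k (x l)"
proof (induction k)
  case (Suc k)
  hence "x (Suc (l - Suc k)) \<in> nbrs E (x (l - Suc k))" by (intro assms) simp
  hence "x (l - k) \<in> nbrs E (x (l - Suc k))" using Suc.prems by (simp add: Suc_diff_Suc)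
  thus ?case using Suc by (auto simp: nbrs_sym)
qed simp

text \<open>The first repeated vertex of a non-backtracking walk closes a cycle.\<close>

lemma closed_nb_walk_cycle:
  assumes step: "\<And>i. i < l \<Longrightarrow> x (Suc i) \<in> nbrs E (x i)"
    and nb: "\<And>i. Suc i < l \<Longrightarrow> x i \<noteq> x (Suc (Suc i))"
    and loop: "\<And>z. z \<notin> nbrs E z"
    and closed: "x 0 = x l" "0 < l" and V: "\<And>i. i \<le> l \<Longrightarrow> x i \<in> V"
  shows "\<exists>c i. 3 \<le> c \<and> c \<le> l \<and> i \<le> l \<and> map x [i..<i + c] \<in> cycles V c E"
proof -
  define j where "j = (LEAST j. \<exists>i<j. x i = x j)"
  have ex: "\<exists>j. \<exists>i<j. x i = x j" using closed by blast
  obtain i where i: "i < j" "x i = x j" unfolding j_def using LeastI_ex[OF ex] by blast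
  have jl: "j \<le> l" unfolding j_def using closed by (intro Least_le) blast
  have inj: "a = b" if "a < j" "b < j" "x a = x b" for a b
    using not_less_Least[of a "\<lambda>j. \<exists>i<j. x i = x j"] not_less_Least[of b "\<lambda>j. \<exists>i<j. x i = x j"]
      that unfolding j_def by (metis linorder_neqE_nat)
  define c where "c = j - i"
  have c: "3 \<le> c"
  proof (rule ccontr)
    assume "\<not> 3 \<le> c"
    hence "j = Suc i \<or> j = Suc (Suc i)" using i by (auto simp: c_def)
    thus False
    proof
      assume "j = Suc i"
      thus False using step[of i] i jl loop by auto
    next
      assume "j = Suc (Suc i)"
      thus False using nb[of i] i jl by auto
    qed
  qed
  let ?xs = "map x [i..<i + c]"
  have ic: "i + c = j" using i by (simp add: c_def)
  have "distinct ?xs" using inj by (auto simp: distinct_map inj_on_def ic)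
  moreover have "set ?xs \<subseteq> V" using V jl by (auto simp: ic)
  moreover have "cyc_edges ?xs \<subseteq> E"
  proof
    fix e assume "e \<in> cyc_edges ?xs"
    then obtain t where t: "t < c" "e = {?xs ! t, ?xs ! (Suc t mod c)}"
      by (auto simp: cyc_edges_def)
    have "?xs ! (Suc t mod c) = x (Suc (i + t))"
    proof (cases "Suc t = c")
      case True
      hence "Suc (i + t) = j" using ic by simp
      thus ?thesis using True i c by simp
    qed (use t in auto)
    hence "e = {x (i + t), x (Suc (i + t))}" using t by simp
    thus "e \<in> E" using step[of "i + t"] t jl ic by (simp add: nbrs_def)
  qed
  ultimately have "?xs \<in> cycles V c E" by (simp add: cycles_def)
  moreover have "c \<le> l" "i \<le> l" using jl ic by auto
  ultimately show ?thesis using c by blast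
qed

text \<open>A vertex that carries a closed non-backtracking walk of length s lies within s steps of
  the first vertex of some listed cycle of length 3 to s. Each such cycle accounts for at most (s +
  1) d^s vertices, and each vertex for at most d^s walks.\<close>

lemma sum_closed_nb_walks_le:
  assumes deg: "\<And>x. card (nbrs E x) \<le> d" and fin: "\<And>x. finite (nbrs E x)"
    and loop: "\<And>z. z \<notin> nbrs E z" and V: "\<And>z. nbrs E z \<subseteq> V" "finite V"
    and U: "U \<subseteq> V" and d: "1 \<le> d" and s: "0 < s"
  shows "(\<Sum>v\<in>U. nb_walks E v s v)
    \<le> real (Suc s) * real d ^ (2 * s) * (\<Sum>c=3..s. real (card (cycles V c E)))"
proof -
  define B where "B = {v \<in> V. nb_walks E v s v \<noteq> 0}"
  have finU: "finite U" using U V finite_subset by blast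
  have sub: "B \<subseteq> (\<Union>c\<in>{3..s}. \<Union>xs\<in>cycles V c E. \<Union>i\<le>s. walk_ends E i (hd xs))"
  proof
    fix v assume v: "v \<in> B"
    obtain t where t: "s = Suc t" using s by (cases s) auto
    have "(\<Sum>w\<in>nbrs E v. nb_arcs E v t w v) \<noteq> 0" using v by (simp add: B_def t)
    then obtain w where "nb_arcs E v t w v \<noteq> 0" by (rule sum.not_neutral_contains_not_neutral)
    from nb_arcs_walk[OF this] obtain x where x: "x 0 = v" "x (Suc t) = v"
      "\<forall>i\<le>t. x (Suc i) \<in> nbrs E (x i)" "\<forall>i<t. x i \<noteq> x (Suc (Suc i))" by blast
    have step: "x (Suc i) \<in> nbrs E (x i)" if "i < s" for i using x that t by auto
    have xV: "x i \<in> V" if "i \<le> s" for i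
      using that x(1,3) v V(1) t by (cases i) (auto simp: B_def)
    have "\<exists>c i. 3 \<le> c \<and> c \<le> s \<and> i \<le> s \<and> map x [i..<i + c] \<in> cycles V c E"
      by (rule closed_nb_walk_cycle) (use step x loop xV t in auto)
    then obtain c i where ci: "3 \<le> c" "c \<le> s" "i \<le> s" "map x [i..<i + c] \<in> cycles V c E"
      by blast
    \<comment> \<open>The walk read backwards from the point where it enters the cycle: its i-th
      vertex is v = x 0.\<close>
    have "x (i - i) \<in> walk_ends E i (x i)"
      by (rule walk_in_walk_ends) (use step ci in auto)
    moreover have "hd (map x [i..<i + c]) = x i" using ci by (simp add: hd_map)
    ultimately have "v \<in> walk_ends E i (hd (map x [i..<i + c]))" using x by simp
    thus "v \<in> (\<Union>c\<in>{3..s}. \<Union>xs\<in>cycles V c E. \<Union>i\<le>s. walk_ends E i (hd xs))"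
      using ci by (intro UN_I[of c] UN_I[of "map x [i..<i + c]"] UN_I[of i]) auto
  qed
  note sph = finite_card_walk_ends[of E d, OF deg fin]
  have finC: "finite (cycles V c E)" for c by (rule finite_cycles[OF V(2)])
  have inner: "card (\<Union>i\<le>s. walk_ends E i z) \<le> Suc s * d ^ s" for z
  proof -
    have "card (\<Union>i\<le>s. walk_ends E i z) \<le> (\<Sum>i\<le>s. card (walk_ends E i z))" by (rule card_UN_le) simp
    also have "\<dots> \<le> (\<Sum>i\<le>s. d ^ s)"
    proof (rule sum_mono)
      fix i assume "i \<in> {..s}"
      hence "d ^ i \<le> d ^ s" using d by (intro power_increasing) auto
      thus "card (walk_ends E i z) \<le> d ^ s" using sph[of i z] by linarith
    qed
    finally show ?thesis by simp
  qed
  have "card B \<le> card (\<Union>c\<in>{3..s}. \<Union>xs\<in>cycles V c E. \<Union>i\<le>s. walk_ends E i (hd xs))"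
    using sub finC sph by (intro card_mono) auto
  also have "\<dots> \<le> (\<Sum>c=3..s. card (\<Union>xs\<in>cycles V c E. \<Union>i\<le>s. walk_ends E i (hd xs)))"
    by (rule card_UN_le) simp
  also have "\<dots> \<le> (\<Sum>c=3..s. \<Sum>xs\<in>cycles V c E. card (\<Union>i\<le>s. walk_ends E i (hd xs)))"
    by (intro sum_mono card_UN_le finC)
  also have "\<dots> \<le> (\<Sum>c=3..s. \<Sum>xs\<in>cycles V c E. Suc s * d ^ s)"
    by (intro sum_mono inner)
  also have "\<dots> = Suc s * d ^ s * (\<Sum>c=3..s. card (cycles V c E))"
    by (simp only: sum_constant sum_distrib_left) (simp add: mult.commute)
  finally have "real (card B) \<le> real (Suc s * d ^ s * (\<Sum>c=3..s. card (cycles V c E)))"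
    by (simp only: of_nat_le_iff)
  hence cB: "real (card B) \<le> real (Suc s) * real d ^ s * (\<Sum>c=3..s. real (card (cycles V c E)))"
    by (simp only: of_nat_mult of_nat_power of_nat_sum)
  have "(\<Sum>v\<in>U. nb_walks E v s v) \<le> (\<Sum>v\<in>B. nb_walks E v s v)"
  proof -
    have "(\<Sum>v\<in>U. nb_walks E v s v) = (\<Sum>v\<in>U \<inter> B. nb_walks E v s v)"
      using finU U by (intro sum.mono_neutral_right) (auto simp: B_def)
    also have "\<dots> \<le> (\<Sum>v\<in>B. nb_walks E v s v)"
      using V(2) by (intro sum_mono2) (auto simp: B_def nb_walks_nonneg)
    finally show ?thesis .
  qed
  also have "\<dots> \<le> real (card B) * real d ^ s"
    using sum_bounded_above[of B "\<lambda>v. nb_walks E v s v" "real d ^ s"]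
      nb_walks_le[of E d, OF deg fin] by simp
  also have "\<dots> \<le> real (Suc s) * real d ^ s * (\<Sum>c=3..s. real (card (cycles V c E))) * real d ^ s"
    by (intro mult_right_mono cB) simp
  also have "\<dots> = real (Suc s) * real d ^ (2 * s) * (\<Sum>c=3..s. real (card (cycles V c E)))"
    unfolding mult_2 power_add by (simp only: mult_ac)
  finally show ?thesis .
qed

subsection \<open>Traces of powers of the adjacency kernel\<close>

definition unit_at :: "'a \<Rightarrow> 'a \<Rightarrow> real" where
  "unit_at v x = (if x = v then 1 else 0)"

text \<open>\<open>funpow\<close> peels off the outermost factor of the power; here the innermost
  one is peeled off, which amounts to saying that an operator commutes with its powers.\<close>

lemma kernel_power_commute:
  assumes "finite V" and "v \<in> V"
  shows "x \<in> V \<Longrightarrow> (kernel_apply V K ^^ Suc j) (unit_at v) x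
    = (\<Sum>z\<in>V. (kernel_apply V K ^^ j) (unit_at z) x * K z v)"
proof (induction j arbitrary: x)
  case 0
  have "(\<Sum>z\<in>V. unit_at z x * K z v) = (\<Sum>z\<in>V. if z = x then K x v else 0)"
    by (auto simp: unit_at_def intro!: sum.cong)
  moreover have "(\<Sum>z\<in>V. K x z * unit_at v z) = (\<Sum>z\<in>V. if z = v then K x v else 0)"
    by (auto simp: unit_at_def intro!: sum.cong)
  ultimately show ?case using assms 0 by (simp add: kernel_apply_def)
next
  case (Suc j)
  have "(kernel_apply V K ^^ Suc (Suc j)) (unit_at v) x
      = (\<Sum>w\<in>V. K x w * (kernel_apply V K ^^ Suc j) (unit_at v) w)"
    by (subst funpow.simps) (simp add: kernel_apply_def)
  also have "\<dots> = (\<Sum>w\<in>V. K x w * (\<Sum>z\<in>V. (kernel_apply V K ^^ j) (unit_at z) w * K z v))"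
    using Suc.IH by simp
  also have "\<dots> = (\<Sum>z\<in>V. (\<Sum>w\<in>V. K x w * (kernel_apply V K ^^ j) (unit_at z) w) * K z v)"
    unfolding sum_distrib_left sum_distrib_right by (subst sum.swap) (simp add: mult_ac)
  also have "(\<lambda>z. \<Sum>w\<in>V. K x w * (kernel_apply V K ^^ j) (unit_at z) w)
      = (\<lambda>z. (kernel_apply V K ^^ Suc j) (unit_at z) x)"
    by (simp add: kernel_apply_def[of V K "(kernel_apply V K ^^ j) _"])
  finally show ?case .
qed

text \<open>Cyclicity of the trace across the two blocks: a closed walk of positive length from
  \<open>L\<close> has its first step into \<open>R\<close>, and rotating it by that step gives a
  closed walk from \<open>R\<close>. For exponent 0 the two sides would be |L| + |R| and 2
  |R|.\<close>

lemma trace_bipartite_kernel: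
  assumes fin: "finite L" "finite R" and disj: "L \<inter> R = {}"
    and LL: "\<And>x z. x \<in> L \<Longrightarrow> z \<in> L \<Longrightarrow> K x z = 0"
    and RR: "\<And>x z. x \<in> R \<Longrightarrow> z \<in> R \<Longrightarrow> K x z = 0"
  defines "T \<equiv> kernel_apply (L \<union> R) K"
  shows "(\<Sum>v\<in>L \<union> R. (T ^^ Suc j) (unit_at v) v) = 2 * (\<Sum>v\<in>R. (T ^^ Suc j) (unit_at v) v)"
proof -
  have "(\<Sum>v\<in>L. (T ^^ Suc j) (unit_at v) v) = (\<Sum>v\<in>L. \<Sum>z\<in>L \<union> R. K v z * (T ^^ j) (unit_at v) z)"
    by (simp add: T_def kernel_apply_def)
  also have "\<dots> = (\<Sum>v\<in>L. \<Sum>z\<in>R. K v z * (T ^^ j) (unit_at v) z)"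
    using fin LL by (intro sum.cong sum.mono_neutral_right) auto
  also have "\<dots> = (\<Sum>z\<in>R. \<Sum>v\<in>L. (T ^^ j) (unit_at v) z * K v z)"
    by (subst sum.swap) (simp add: mult.commute)
  also have "\<dots> = (\<Sum>z\<in>R. \<Sum>v\<in>L \<union> R. (T ^^ j) (unit_at v) z * K v z)"
    using fin RR by (intro sum.cong sum.mono_neutral_left) auto
  also have "\<dots> = (\<Sum>v\<in>R. (T ^^ Suc j) (unit_at v) v)"
    unfolding T_def by (intro sum.cong refl kernel_power_commute[symmetric]) (use fin in auto)
  finally show ?thesis using fin disj by (simp add: sum.union_disjoint)
qed

text \<open>The number of ways to step back in the non-backtracking recursion, divided by
  \<open>dR\<close>. Index s belongs to walks of length s - 1 from \<open>R\<close>, which end in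
  \<open>R\<close> when s is odd; at s = 1 the full degree \<open>dR\<close> counts.\<close>

definition walk_coeff :: "nat \<Rightarrow> nat \<Rightarrow> nat \<Rightarrow> real" where
  "walk_coeff dL dR s = (if s = 1 then 1 else
     (if even s then real dL - 1 else real dR - 1) / real dR)"

definition adj_kernel :: "real \<Rightarrow> nat set set \<Rightarrow> nat \<Rightarrow> nat \<Rightarrow> real" where
  "adj_kernel r E x z = (if {x, z} \<in> E then r else 0)"

lemma kernel_apply_adj:
  assumes "finite V" "nbrs E x \<subseteq> V"
  shows "kernel_apply V (adj_kernel r E) f x = r * (\<Sum>z\<in>nbrs E x. f z)"
proof -
  have "kernel_apply V (adj_kernel r E) f x = (\<Sum>z\<in>V. if z \<in> nbrs E x then r * f z else 0)"
    by (auto simp: kernel_apply_def adj_kernel_def nbrs_def intro!: sum.cong)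
  also have "\<dots> = (\<Sum>z\<in>V \<inter> nbrs E x. r * f z)" using assms by (simp add: sum.inter_restrict)
  also have "V \<inter> nbrs E x = nbrs E x" using assms by auto
  finally show ?thesis by (simp add: sum_distrib_left)
qed

section \<open>Walks in a fixed biregular graph\<close>

context
  fixes m n dL dR :: nat and E :: "nat set set"
  assumes E: "E \<in> biregular_graphs m n dL dR"
begin

lemma graph_sub: "E \<subseteq> bipartite_edges {..<m} {m..<m + n}"
  and graph_biregular: "biregular {..<m} {m..<m + n} dL dR E"
  using E by (simp_all add: biregular_graphs_def biregular_def)

lemma sides_disjoint: "{..<m} \<inter> {m..<m + n} = {}"
  by auto

lemma nbrs_side:
  assumes "w \<in> nbrs E x"
  shows "x < m \<and> w \<in> {m..<m + n} \<or> x \<in> {m..<m + n} \<and> w < m"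
  using bipartite_adjacent[OF sides_disjoint graph_sub, of x w] assms by (auto simp: nbrs_def)

lemma nbrs_sub: "nbrs E x \<subseteq> {..<m + n}"
  using nbrs_side by fastforce

lemma finite_nbrs_graph: "finite (nbrs E x)"
  using nbrs_sub finite_subset by blast

lemma card_nbrs_L: "x < m \<Longrightarrow> card (nbrs E x) = dL"
  and card_nbrs_R: "x \<in> {m..<m + n} \<Longrightarrow> card (nbrs E x) = dR"
  using biregular_card_nbrs[OF sides_disjoint graph_biregular, of x] by (auto simp: nbrs_def)

lemma nbrs_outside: "m + n \<le> x \<Longrightarrow> nbrs E x = {}"
  using nbrs_side[of _ x] by fastforce

lemma card_nbrs_le: "dL \<le> dR \<Longrightarrow> card (nbrs E x) \<le> dR"
  using card_nbrs_L[of x] card_nbrs_R[of x] nbrs_outside[of x]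
  by (cases "x < m"; cases "x < m + n") auto

lemma no_loop: "z \<notin> nbrs E z"
  using nbrs_side[of z z] by auto

lemma nb_arcs_parity:
  assumes v0: "v0 \<in> {m..<m + n}"
  shows "nb_arcs E v0 s w v \<noteq> 0 \<Longrightarrow> v \<in> nbrs E w \<and> (w \<in> {m..<m + n} \<longleftrightarrow> even s)"
proof (induction s arbitrary: w v)
  case 0
  thus ?case using v0 by (auto split: if_splits)
next
  case (Suc s)
  hence v: "v \<in> nbrs E w" by (auto split: if_splits)
  with Suc.prems obtain u where u: "nb_arcs E v0 s u w \<noteq> 0"
    by (auto elim!: sum.not_neutral_contains_not_neutral)
  from Suc.IH[OF u] have "w \<in> nbrs E u" "u \<in> {m..<m + n} \<longleftrightarrow> even s" by auto
  hence "w \<in> {m..<m + n} \<longleftrightarrow> even (Suc s)" using nbrs_side[of w u] by auto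
  thus ?case using v by simp
qed

lemma nb_walks_parity:
  assumes v0: "v0 \<in> {m..<m + n}" and nz: "nb_walks E v0 s x \<noteq> 0"
  shows "even s \<longleftrightarrow> x \<in> {m..<m + n}"
proof (cases s)
  case 0
  thus ?thesis using assms by (auto split: if_splits)
next
  case (Suc t)
  then obtain w where "w \<in> nbrs E x" "nb_arcs E v0 t w x \<noteq> 0"
    using nz by (auto elim!: sum.not_neutral_contains_not_neutral)
  thus ?thesis using nb_arcs_parity[OF v0, of t w x] nbrs_side[of x w] Suc by auto
qed

text \<open>The number of backward steps depends on the side of x, the coefficient only on s. They
  agree because a walk from \<open>R\<close> ends in \<open>R\<close> exactly when its length is
  even, and where no walk of length s ends the coefficient is multiplied by 0.\<close>

lemma nb_walks_recursion:
  assumes v0: "v0 \<in> {m..<m + n}" and d: "0 < dR" and x: "x < m + n"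
  shows "(\<Sum>v\<in>nbrs E x. nb_walks E v0 (Suc s) v)
    = nb_walks E v0 (Suc (Suc s)) x + real dR * walk_coeff dL dR (Suc s) * nb_walks E v0 s x"
proof (cases s)
  case 0
  have "real (card (nbrs E x)) * nb_walks E v0 0 x = real dR * nb_walks E v0 0 x"
    using v0 card_nbrs_R[of x] by auto
  thus ?thesis
    using nb_walks_Suc_step[of E v0 0 x, OF finite_nbrs_graph] nb_arcs_0_back[of E v0 x] 0
    by (simp only: walk_coeff_def) simp
next
  case (Suc t)
  have "(real (card (nbrs E x)) - 1) * nb_walks E v0 s x
      = real dR * walk_coeff dL dR (Suc s) * nb_walks E v0 s x"
  proof (cases "nb_walks E v0 s x = 0")
    case False
    hence "even s \<longleftrightarrow> x \<in> {m..<m + n}" by (rule nb_walks_parity[OF v0])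
    thus ?thesis using Suc d x card_nbrs_L[of x] card_nbrs_R[of x]
      by (auto simp: walk_coeff_def)
  qed simp
  thus ?thesis
    using nb_walks_Suc_step[of E v0 s x, OF finite_nbrs_graph]
      nb_arcs_Suc_back[OF finite_nbrs_graph, of v0 t x] Suc by (simp only:)
qed

lemma kernel_power_expansion:
  assumes v0: "v0 \<in> {m..<m + n}" and d: "0 < dR"
  shows "(kernel_apply {..<m + n} (adj_kernel (1 / sqrt (real dR)) E) ^^ j) (unit_at v0) v0
    = (\<Sum>s\<le>j. jacobi_coeff (walk_coeff dL dR) j s * (nb_walks E v0 s v0 / sqrt (real dR) ^ s))"
proof -
  let ?r = "sqrt (real dR)"
  have r: "?r > 0" "?r * ?r = real dR" using d by simp_all
  \<comment> \<open>Scaling by sqrt(dR)^s absorbs the factor of the kernel and makes the recursion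
    monic.\<close>
  define p where "p s x = nb_walks E v0 s x / ?r ^ s" for s x
  let ?T = "kernel_apply {..<m + n} (adj_kernel (1 / ?r) E)"
  have T: "?T (p s) x = (\<Sum>v\<in>nbrs E x. nb_walks E v0 s v) / ?r ^ Suc s" for s x
    using nbrs_sub by (subst kernel_apply_adj) (simp_all add: p_def flip: sum_divide_distrib)
  have "(?T ^^ j) (p 0) v0 = (\<Sum>s\<le>j. jacobi_coeff (walk_coeff dL dR) j s * p s v0)"
  proof (rule jacobi_expansion)
    show "?T (p 0) x = p (Suc 0) x" for x
      unfolding T nb_walks_0_step[OF finite_nbrs_graph] by (simp add: p_def)
    show "?T (p (Suc s)) x = p (Suc (Suc s)) x + walk_coeff dL dR (Suc s) * p s x"
      if "x \<in> {..<m + n}" for s x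
    proof -
      have "real dR / ?r ^ Suc (Suc s) = 1 / ?r ^ s" using r by (simp add: field_simps)
      hence "real dR * w * q / ?r ^ Suc (Suc s) = w * (q / ?r ^ s)" for w q
        by (metis mult.assoc mult.commute mult_1 times_divide_eq_left)
      thus ?thesis
        unfolding T using nb_walks_recursion[OF v0 d, of x s] that
        by (simp only: p_def add_divide_distrib lessThan_iff)
    qed
  qed (use v0 in auto)
  moreover have "p 0 = unit_at v0" by (auto simp: p_def unit_at_def)
  ultimately show ?thesis by (simp add: p_def)
qed

text \<open>The term s = 0 of the expansion contributes 1 at each vertex of \<open>R\<close>, hence
  n times \<open>c 0\<close>, and the trace doubles this. The terms with s > 0 are closed
  non-backtracking walks, controlled by short cycles.\<close>

lemma trace_adj_kernel:
  fixes j :: nat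
  assumes d: "1 \<le> dR" and le: "dL \<le> dR"
  defines "T \<equiv> kernel_apply {..<m + n} (adj_kernel (1 / sqrt (real dR)) E)"
  defines "c \<equiv> jacobi_coeff (walk_coeff dL dR) (Suc j)"
  shows "\<bar>(\<Sum>v<m + n. (T ^^ Suc j) (unit_at v) v) - 2 * real n * c 0\<bar>
    \<le> 2 * (\<Sum>s=1..Suc j. \<bar>c s\<bar> * (real (Suc s) * real dR ^ (2 * s) *
         (\<Sum>i=3..s. real (card (cycles {..<m + n} i E)))))"
proof -
  let ?r = "sqrt (real dR)" and ?R = "{m..<m + n}"
  let ?X = "\<lambda>s. real (Suc s) * real dR ^ (2 * s) * (\<Sum>i=3..s. real (card (cycles {..<m + n} i E)))"
  define Y where "Y s = (\<Sum>v\<in>?R. nb_walks E v s v)" for s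
  have V: "{..<m + n} = {..<m} \<union> ?R" by auto
  have "(\<Sum>v<m + n. (T ^^ Suc j) (unit_at v) v) = 2 * (\<Sum>v\<in>?R. (T ^^ Suc j) (unit_at v) v)"
    unfolding T_def V
  proof (rule trace_bipartite_kernel)
    show "adj_kernel (1 / ?r) E x z = 0" if "x \<in> {..<m}" "z \<in> {..<m}" for x z
      using nbrs_side[of z x] that by (auto simp: adj_kernel_def nbrs_def)
    show "adj_kernel (1 / ?r) E x z = 0" if "x \<in> ?R" "z \<in> ?R" for x z
      using nbrs_side[of z x] that by (auto simp: adj_kernel_def nbrs_def)
  qed auto
  also have "(\<Sum>v\<in>?R. (T ^^ Suc j) (unit_at v) v)
      = (\<Sum>v\<in>?R. \<Sum>s\<le>Suc j. c s * (nb_walks E v s v / ?r ^ s))"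
    unfolding T_def c_def using d by (intro sum.cong refl kernel_power_expansion) auto
  also have "\<dots> = (\<Sum>s\<le>Suc j. c s * (Y s / ?r ^ s))"
    unfolding Y_def by (subst sum.swap) (simp add: sum_distrib_left sum_divide_distrib)
  also have "\<dots> = c 0 * real n + (\<Sum>s=1..Suc j. c s * (Y s / ?r ^ s))"
    by (simp add: Y_def sum.atLeast_Suc_atMost atMost_atLeast0 del: sum.cl_ivl_Suc)
  finally have "(\<Sum>v<m + n. (T ^^ Suc j) (unit_at v) v) - 2 * real n * c 0
      = 2 * (\<Sum>s=1..Suc j. c s * (Y s / ?r ^ s))" by simp
  hence "\<bar>(\<Sum>v<m + n. (T ^^ Suc j) (unit_at v) v) - 2 * real n * c 0\<bar>
      = 2 * \<bar>\<Sum>s=1..Suc j. c s * (Y s / ?r ^ s)\<bar>" by (simp only: abs_mult abs_numeral)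
  also have "\<dots> \<le> 2 * (\<Sum>s=1..Suc j. \<bar>c s * (Y s / ?r ^ s)\<bar>)"
    by (intro mult_left_mono sum_abs) simp
  also have "\<dots> \<le> 2 * (\<Sum>s=1..Suc j. \<bar>c s\<bar> * ?X s)"
  proof (intro mult_left_mono sum_mono)
    fix s assume s: "s \<in> {1..Suc j}"
    have Y0: "0 \<le> Y s" by (simp add: Y_def sum_nonneg nb_walks_nonneg)
    \<comment> \<open>The gain sqrt(dR)^s is given away, since powers of \<open>dR\<close> do not
      matter.\<close>
    have "1 \<le> ?r ^ s" using d by (intro one_le_power) simp
    hence "Y s / ?r ^ s \<le> Y s / 1" using Y0 by (intro divide_left_mono) auto
    also have "\<dots> \<le> ?X s" unfolding Y_def div_by_1
      using s d card_nbrs_le[OF le] finite_nbrs_graph no_loop nbrs_sub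
      by (intro sum_closed_nb_walks_le) auto
    finally have "Y s / ?r ^ s \<le> ?X s" .
    moreover have "0 \<le> Y s / ?r ^ s" using Y0 by simp
    ultimately show "\<bar>c s * (Y s / ?r ^ s)\<bar> \<le> \<bar>c s\<bar> * ?X s"
      unfolding abs_mult by (intro mult_left_mono) auto
  qed simp
  finally show ?thesis .
qed

end

subsection \<open>Moments of the empirical spectral distribution\<close>

lemma split_poly_eq_prod_proots:
  fixes p :: "'a :: idom poly"
  assumes "p \<noteq> 0" "size (proots p) = degree p"
  shows "p = Polynomial.smult (lead_coeff p) (\<Prod>a\<in>#proots p. [:- a, 1:])"
  using assms
proof (induction "degree p" arbitrary: p)
  case 0
  then obtain c where "p = [:c:]" using degree_eq_zeroE by metis
  thus ?case by simp
next
  case (Suc d)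
  hence "proots p \<noteq> {#}" by auto
  then obtain a where "a \<in># proots p" by blast
  hence "poly p a = 0" using Suc by simp
  then obtain q where q: "p = [:- a, 1:] * q" by (auto simp: poly_eq_0_iff_dvd)
  hence q0: "q \<noteq> 0" using Suc by auto
  have pr: "proots p = add_mset a (proots q)" unfolding q using q0 by (subst proots_mult) auto
  have dg: "degree p = Suc (degree q)" unfolding q using q0 by (subst degree_mult_eq) auto
  have lc: "lead_coeff p = lead_coeff q" unfolding q lead_coeff_mult by simp
  have "q = Polynomial.smult (lead_coeff q) (\<Prod>a\<in>#proots q. [:- a, 1:])"
    by (rule Suc.hyps(1)) (use Suc dg pr q0 in auto)
  hence "p = [:- a, 1:] * Polynomial.smult (lead_coeff q) (\<Prod>a\<in>#proots q. [:- a, 1:])" using q by simp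
  also have "\<dots> = Polynomial.smult (lead_coeff p) (\<Prod>a\<in>#proots p. [:- a, 1:])"
    by (simp only: pr lc image_mset_add_mset prod_mset.add_mset mult_smult_right)
  finally show ?case .
qed

definition mat_trace :: "'a :: comm_monoid_add mat \<Rightarrow> 'a" where
  "mat_trace A = (\<Sum>i<dim_row A. A $$ (i, i))"

lemma mat_trace_comm:
  fixes A B :: "'a :: comm_semiring_0 mat"
  assumes "A \<in> carrier_mat n k" "B \<in> carrier_mat k n"
  shows "mat_trace (A * B) = mat_trace (B * A)"
proof -
  have "mat_trace (A * B) = (\<Sum>i<n. \<Sum>j<k. A $$ (i, j) * B $$ (j, i))"
    using assms by (auto simp: mat_trace_def scalar_prod_def lessThan_atLeast0 intro!: sum.cong)
  also have "\<dots> = (\<Sum>j<k. \<Sum>i<n. B $$ (j, i) * A $$ (i, j))"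
    by (subst sum.swap) (simp add: mult.commute)
  also have "\<dots> = mat_trace (B * A)"
    using assms by (auto simp: mat_trace_def scalar_prod_def lessThan_atLeast0 intro!: sum.cong)
  finally show ?thesis .
qed

lemma pow_upper_triangular:
  fixes B :: "'a :: comm_semiring_1 mat"
  assumes B: "B \<in> carrier_mat n n" and ut: "upper_triangular B"
  shows "upper_triangular (B ^\<^sub>m k) \<and> (\<forall>i<n. (B ^\<^sub>m k) $$ (i, i) = (B $$ (i, i)) ^ k)"
proof (induction k)
  case (Suc k)
  let ?P = "B ^\<^sub>m k"
  have P: "?P \<in> carrier_mat n n" using B by simp
  have up: "?P $$ (i, j) = 0" if "j < i" "i < n" for i j
    using Suc that P by (auto simp: upper_triangular_def)
  have ub: "B $$ (i, j) = 0" if "j < i" "i < n" for i j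
    using ut that B by (auto simp: upper_triangular_def)
  have e: "(?P * B) $$ (i, j) = (\<Sum>l<n. ?P $$ (i, l) * B $$ (l, j))" if "i < n" "j < n" for i j
    using that P B by (auto simp: scalar_prod_def lessThan_atLeast0 intro!: sum.cong)
  have "(?P * B) $$ (i, j) = 0" if "j < i" "i < n" for i j
  proof -
    have "?P $$ (i, l) * B $$ (l, j) = 0" if "l < n" for l
      using up[of l i] ub[of j l] that \<open>j < i\<close> \<open>i < n\<close> by (cases "l < i") auto
    thus ?thesis using that e by simp
  qed
  hence "upper_triangular (?P * B)" using B by (auto simp: upper_triangular_def)
  moreover have "(?P * B) $$ (i, i) = (B $$ (i, i)) ^ Suc k" if i: "i < n" for i
  proof -
    have "(\<Sum>l<n. ?P $$ (i, l) * B $$ (l, i)) = (\<Sum>l\<in>{i}. ?P $$ (i, l) * B $$ (l, i))"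
    proof (rule sum.mono_neutral_right)
      show "\<forall>l\<in>{..<n} - {i}. ?P $$ (i, l) * B $$ (l, i) = 0"
      proof
        fix l assume "l \<in> {..<n} - {i}"
        thus "?P $$ (i, l) * B $$ (l, i) = 0"
          using up[of l i] ub[of i l] i by (cases "l < i") auto
      qed
    qed (use i in auto)
    thus ?thesis using Suc i e[OF i i] by (simp add: mult.commute)
  qed
  ultimately show ?case by simp
qed (use B in auto)

text \<open>The characteristic polynomial splits over the reals, so A is similar to a real
  triangular matrix with the eigenvalues on the diagonal. Its k-th power has their k-th powers
  there, and similarity preserves the trace.\<close>

lemma sum_powers_proots_char_poly:
  fixes A :: "real mat"
  assumes A: "A \<in> carrier_mat n n" and sym: "A\<^sup>T = A"
  shows "(\<Sum>x\<in>#proots (char_poly A). x ^ k) = mat_trace (A ^\<^sub>m k)"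
proof -
  have mon: "degree (char_poly A) = n" "monic (char_poly A)"
    using degree_monic_char_poly[OF A] by auto
  hence ne: "char_poly A \<noteq> 0" by auto
  obtain es where es: "mset es = proots (char_poly A)" using ex_mset by blast
  have "char_poly A = (\<Prod>a\<in>#proots (char_poly A). [:- a, 1:])"
    using split_poly_eq_prod_proots[OF ne] size_proots_char_poly[OF A sym] mon by simp
  hence cp: "char_poly A = (\<Prod>a\<leftarrow>es. [:- a, 1:])"
    unfolding es[symmetric] mset_map[symmetric] prod_mset_prod_list .
  obtain B P Q where S: "schur_decomposition A es = (B, P, Q)" by (cases "schur_decomposition A es")
  from schur_decomposition[OF A cp S] have wit: "similar_mat_wit A B P Q"
    and ut: "upper_triangular B" and diag: "diag_mat B = es" by auto
  note w = similar_mat_witD2[OF A wit]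
  have B: "B \<in> carrier_mat n n" using w by auto
  have "mat_trace (A ^\<^sub>m k) = mat_trace (P * (B ^\<^sub>m k * Q))"
    using similar_mat_wit_pow_id[OF wit, of k] w by (simp add: assoc_mult_mat[of _ n n _ n _ n])
  also have "\<dots> = mat_trace ((B ^\<^sub>m k * Q) * P)"
    using w by (intro mat_trace_comm[of _ n n]) auto
  also have "(B ^\<^sub>m k * Q) * P = B ^\<^sub>m k"
    using w by (simp add: assoc_mult_mat[of _ n n _ n _ n] right_mult_one_mat[of _ n n])
  also have "mat_trace (B ^\<^sub>m k) = (\<Sum>i<n. (B $$ (i, i)) ^ k)"
    using pow_upper_triangular[OF B ut, of k] B by (simp add: mat_trace_def)
  also have "\<dots> = (\<Sum>x\<leftarrow>diag_mat B. x ^ k)"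
    using B by (simp add: diag_mat_def o_def interv_sum_list_conv_sum_set_nat lessThan_atLeast0)
  also have "\<dots> = (\<Sum>x\<in>#proots (char_poly A). x ^ k)"
    unfolding diag es[symmetric] mset_map[symmetric] sum_mset_sum_list ..
  finally show ?thesis ..
qed

lemma mat_pow_eq_kernel_power:
  fixes K :: "nat \<Rightarrow> nat \<Rightarrow> real"
  assumes v: "v < N"
  shows "x < N \<Longrightarrow> (mat N N (\<lambda>(i, j). K i j) ^\<^sub>m k) $$ (x, v)
    = (kernel_apply {..<N} K ^^ k) (unit_at v) x"
  using v
proof (induction k arbitrary: x v)
  case 0
  thus ?case by (auto simp: unit_at_def)
next
  case (Suc k)
  let ?M = "mat N N (\<lambda>(i, j). K i j)"
  have M: "?M \<in> carrier_mat N N" "?M ^\<^sub>m k \<in> carrier_mat N N" by auto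
  have "(?M ^\<^sub>m Suc k) $$ (x, v) = (\<Sum>z<N. (?M ^\<^sub>m k) $$ (x, z) * K z v)"
    using Suc.prems M by (auto simp: scalar_prod_def lessThan_atLeast0 intro!: sum.cong)
  also have "\<dots> = (\<Sum>z<N. (kernel_apply {..<N} K ^^ k) (unit_at z) x * K z v)"
    using Suc by (intro sum.cong) auto
  also have "\<dots> = (kernel_apply {..<N} K ^^ Suc k) (unit_at v) x"
    using Suc.prems by (intro kernel_power_commute[symmetric]) auto
  finally show ?case .
qed

lemma moment_esd:
  fixes r :: real
  assumes N: "0 < N"
  shows "(\<integral>x. x ^ k \<partial>esd (r \<cdot>\<^sub>m adjacency_mat N E))
    = (\<Sum>v<N. (kernel_apply {..<N} (adj_kernel r E) ^^ k) (unit_at v) v) / real N"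
proof -
  let ?A = "r \<cdot>\<^sub>m adjacency_mat N E"
  have A: "?A \<in> carrier_mat N N" by simp
  have sym: "?A\<^sup>T = ?A"
    using transpose_adjacency_mat[of N E] by (intro eq_matI) (auto simp: adjacency_mat_def insert_commute)
  have eq: "?A = mat N N (\<lambda>(i, j). adj_kernel r E i j)"
    by (rule eq_matI) (auto simp: adjacency_mat_def adj_kernel_def)
  have "(\<integral>x. x ^ k \<partial>esd ?A) = (\<Sum>x\<in>#proots (char_poly ?A). x ^ k) / real N"
    by (rule integral_esd[OF A sym N]) simp
  also have "\<dots> = mat_trace (?A ^\<^sub>m k) / real N"
    by (simp only: sum_powers_proots_char_poly[OF A sym])
  also have "mat_trace (?A ^\<^sub>m k) = (\<Sum>v<N. (kernel_apply {..<N} (adj_kernel r E) ^^ k) (unit_at v) v)"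
    unfolding eq mat_trace_def by (intro sum.cong mat_pow_eq_kernel_power) auto
  finally show ?thesis .
qed

lemma prob_space_esd:
  "prob_space (esd A)"
  unfolding esd_def by (intro prob_space.prob_space_distr measure_pmf.prob_space_axioms) simp

lemma sets_esd [simp]: "sets (esd A) = sets borel"
  by (simp add: esd_def)

lemma integrable_esd:
  assumes A: "A \<in> carrier_mat n n" and sym: "A\<^sup>T = A" and n: "n > 0"
    and f: "f \<in> borel_measurable borel"
  shows "integrable (esd A) (f :: real \<Rightarrow> real)"
proof -
  have "proots (char_poly A) \<noteq> {#}" using size_proots_char_poly[OF A sym] n by auto
  hence "finite (set_pmf (pmf_of_multiset (proots (char_poly A))))" by simp
  thus ?thesis unfolding esd_def using f
    by (subst integrable_distr_eq) (auto intro: integrable_measure_pmf_finite)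
qed

subsection \<open>The method of moments\<close>

text \<open>Turns a pointwise error into one expressed by moments alone; it is applied both to the
  approximating measures and to the limit.\<close>

lemma abs_diff_integral_le:
  fixes \<nu> :: "real measure" and f :: "real \<Rightarrow> real"
  assumes "prob_space \<nu>" "sets \<nu> = sets borel"
    and int: "\<And>j. integrable \<nu> (\<lambda>x. x ^ j)"
    and f: "f \<in> borel_measurable borel" "\<And>x. \<bar>f x\<bar> \<le> M"
    and bound: "\<And>x. \<bar>f x - (\<Sum>i\<le>d. a i * x ^ i)\<bar> \<le> e + C * x ^ (2 * l)"
  shows "\<bar>(\<integral>x. f x \<partial>\<nu>) - (\<Sum>i\<le>d. a i * (\<integral>x. x ^ i \<partial>\<nu>))\<bar> \<le> e + C * (\<integral>x. x ^ (2 * l) \<partial>\<nu>)"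
proof -
  interpret prob_space \<nu> by fact
  have fi: "integrable \<nu> f"
    using f assms(2) by (intro integrable_const_bound[of _ M]) (auto simp: measurable_def)
  have pi: "integrable \<nu> (\<lambda>x. \<Sum>i\<le>d. a i * x ^ i)" using int by auto
  have "(\<integral>x. f x \<partial>\<nu>) - (\<Sum>i\<le>d. a i * (\<integral>x. x ^ i \<partial>\<nu>))
      = (\<integral>x. f x - (\<Sum>i\<le>d. a i * x ^ i) \<partial>\<nu>)"
    using fi pi int by (subst Bochner_Integration.integral_diff) auto
  also have "\<bar>\<dots>\<bar> \<le> (\<integral>x. \<bar>f x - (\<Sum>i\<le>d. a i * x ^ i)\<bar> \<partial>\<nu>)"
    by (rule integral_abs_bound)
  also have "\<dots> \<le> (\<integral>x. e + C * x ^ (2 * l) \<partial>\<nu>)"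
    using fi pi int bound by (intro integral_mono) auto
  also have "\<dots> = e + C * (\<integral>x. x ^ (2 * l) \<partial>\<nu>)"
    using int[of "2 * l"] prob_space by (subst Bochner_Integration.integral_add) auto
  finally show ?thesis .
qed

text \<open>Outside \<open>[-K - 1, K + 1]\<close> a polynomial of degree at most \<open>2l\<close> is dominated by a multiple
  of \<open>(x / (K + 1)) ^ (2l)\<close>, whose limiting integral is at most \<open>(K / (K + 1)) ^ (2l)\<close>.\<close>

lemma weak_convergence_of_moments:
  fixes \<nu> :: "nat \<Rightarrow> real measure" and \<mu> :: "real measure" and K :: real
    and f :: "real \<Rightarrow> real"
  assumes \<nu>: "\<And>k. prob_space (\<nu> k)" "\<And>k. sets (\<nu> k) = sets borel"
      "\<And>k j. integrable (\<nu> k) (\<lambda>x. x ^ j)"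
    and \<mu>: "prob_space \<mu>" "sets \<mu> = sets borel" "\<And>j. integrable \<mu> (\<lambda>x. x ^ j)"
    and K: "1 \<le> K" "\<And>j. (\<integral>x. x ^ (2 * j) \<partial>\<mu>) \<le> K ^ (2 * j)"
    and mom: "\<And>j. (\<lambda>k. \<integral>x. x ^ j \<partial>\<nu> k) \<longlonglongrightarrow> (\<integral>x. x ^ j \<partial>\<mu>)"
    and f: "continuous_on UNIV f" "bounded (range f)"
  shows "(\<lambda>k. \<integral>x. f x \<partial>\<nu> k) \<longlonglongrightarrow> (\<integral>x. f x \<partial>\<mu>)"
proof (rule LIMSEQ_I)
  fix \<epsilon> :: real assume \<epsilon>: "0 < \<epsilon>"
  \<comment> \<open>Five errors below \<open>e\<close> are added at the end: approximation and tail
    for each of the two measures, and the difference of the polynomial integrals.\<close>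
  define e where "e = \<epsilon> / 8"
  have e: "0 < e" using \<epsilon> by (simp add: e_def)
  have fm: "f \<in> borel_measurable borel" using f(1) by (rule borel_measurable_continuous_onI)
  obtain M where M: "\<And>x. \<bar>f x\<bar> \<le> M" using f(2) by (auto simp: bounded_iff)
  let ?K = "K + 1"
  obtain g where g: "real_polynomial_function g" "\<And>x. x \<in> {-?K..?K} \<Longrightarrow> \<bar>f x - g x\<bar> < e"
    using Stone_Weierstrass_real_polynomial_function[of "{-?K..?K}" f e] f(1) e
      continuous_on_subset by blast
  obtain a d where ga: "g = (\<lambda>x. \<Sum>i\<le>d. a i * x ^ i)"
    using g(1) by (auto simp: real_polynomial_function_iff_sum)
  \<comment> \<open>\<open>A\<close> is fixed by f and the polynomial before l is chosen, so a large
    l makes the geometric factor win.\<close>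
  define A where "A = M + (\<Sum>i\<le>d. \<bar>a i\<bar> * ?K ^ i)"
  have A: "0 \<le> A"
    using M[of 0] K by (auto simp: A_def intro!: add_nonneg_nonneg sum_nonneg)
  have lim0: "(\<lambda>l. A * ((K / ?K)\<^sup>2) ^ l) \<longlonglongrightarrow> A * 0"
    using K by (intro tendsto_intros LIMSEQ_power_zero)
      (simp add: power_less_one_iff abs_square_less_1)
  hence "\<forall>\<^sub>F l in sequentially. A * ((K / ?K)\<^sup>2) ^ l < e" using e by (intro order_tendstoD) auto
  hence "\<forall>\<^sub>F l in sequentially. A * ((K / ?K)\<^sup>2) ^ l < e \<and> d \<le> l"
    by (intro eventually_conj eventually_ge_at_top)
  then obtain l where l: "A * ((K / ?K)\<^sup>2) ^ l < e" "d \<le> l"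
    by (auto simp: eventually_sequentially)
  define C where "C = A / ?K ^ (2 * l)"
  have C: "0 \<le> C" using A K by (simp add: C_def)
  have bound: "\<bar>f x - (\<Sum>i\<le>d. a i * x ^ i)\<bar> \<le> e + C * x ^ (2 * l)" for x
  proof (cases "x \<in> {-?K..?K}")
    case True
    hence "\<bar>f x - (\<Sum>i\<le>d. a i * x ^ i)\<bar> \<le> e" using g(2)[of x] by (simp add: ga)
    moreover have "0 \<le> C * x ^ (2 * l)" using C by simp
    ultimately show ?thesis by linarith
  next
    case False
    hence x: "?K \<le> \<bar>x\<bar>" by auto
    define t where "t = \<bar>x\<bar> / ?K"
    have t: "1 \<le> t" using x K by (simp add: t_def)
    have xt: "\<bar>x\<bar> = ?K * t" using K by (simp add: t_def)
    have "\<bar>f x - (\<Sum>i\<le>d. a i * x ^ i)\<bar> \<le> \<bar>f x\<bar> + \<bar>\<Sum>i\<le>d. a i * x ^ i\<bar>" by (rule abs_triangle_ineq4)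
    also have "\<dots> \<le> M + (\<Sum>i\<le>d. \<bar>a i\<bar> * \<bar>x\<bar> ^ i)"
      using M[of x] sum_abs[of "\<lambda>i. a i * x ^ i" "{..d}"] by (simp add: abs_mult power_abs)
    also have "\<dots> \<le> M * t ^ (2 * l) + (\<Sum>i\<le>d. \<bar>a i\<bar> * ?K ^ i * t ^ (2 * l))"
    proof (intro add_mono sum_mono)
      have "1 \<le> t ^ (2 * l)" using t by (rule one_le_power)
      moreover have "0 \<le> M" using M[of 0] by linarith
      ultimately show "M \<le> M * t ^ (2 * l)" by (simp add: mult_le_cancel_left1)
      fix i assume "i \<in> {..d}"
      hence "t ^ i \<le> t ^ (2 * l)" using t l by (intro power_increasing) auto
      thus "\<bar>a i\<bar> * \<bar>x\<bar> ^ i \<le> \<bar>a i\<bar> * ?K ^ i * t ^ (2 * l)"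
        using K unfolding xt power_mult_distrib mult.assoc by (intro mult_left_mono) auto
    qed
    also have "\<dots> = A * t ^ (2 * l)" by (simp add: A_def distrib_right sum_distrib_right)
    also have "\<dots> = C * x ^ (2 * l)" by (simp add: t_def C_def power_divide power_even_abs)
    finally show ?thesis using e by simp
  qed
  define m where "m = (\<integral>x. x ^ (2 * l) \<partial>\<mu>)"
  define S where "S = (\<Sum>i\<le>d. a i * (\<integral>x. x ^ i \<partial>\<mu>))"
  have "C * m \<le> C * K ^ (2 * l)" using K(2)[of l] C by (intro mult_left_mono) (simp_all add: m_def)
  also have "\<dots> = A * ((K / ?K)\<^sup>2) ^ l" by (simp add: C_def power_divide power_mult)
  finally have Cm: "C * m < e" using l by linarith
  have mu: "\<bar>(\<integral>x. f x \<partial>\<mu>) - S\<bar> \<le> e + C * m"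
    unfolding S_def m_def by (rule abs_diff_integral_le[OF \<mu> fm M bound])
  have nu: "\<bar>(\<integral>x. f x \<partial>\<nu> k) - (\<Sum>i\<le>d. a i * (\<integral>x. x ^ i \<partial>\<nu> k))\<bar> \<le> e + C * (\<integral>x. x ^ (2 * l) \<partial>\<nu> k)" for k
    by (rule abs_diff_integral_le[OF \<nu> fm M bound])
  have "(\<lambda>k. C * (\<integral>x. x ^ (2 * l) \<partial>\<nu> k)) \<longlonglongrightarrow> C * m"
    unfolding m_def by (intro tendsto_intros mom)
  hence ev1: "\<forall>\<^sub>F k in sequentially. C * (\<integral>x. x ^ (2 * l) \<partial>\<nu> k) < e"
    using Cm by (rule order_tendstoD)
  have "(\<lambda>k. \<Sum>i\<le>d. a i * (\<integral>x. x ^ i \<partial>\<nu> k)) \<longlonglongrightarrow> S"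
    unfolding S_def by (intro tendsto_intros mom)
  from tendstoD[OF this e]
  have ev2: "\<forall>\<^sub>F k in sequentially. \<bar>(\<Sum>i\<le>d. a i * (\<integral>x. x ^ i \<partial>\<nu> k)) - S\<bar> < e"
    by (simp add: dist_real_def)
  have "\<forall>\<^sub>F k in sequentially. \<bar>(\<integral>x. f x \<partial>\<nu> k) - (\<integral>x. f x \<partial>\<mu>)\<bar> < \<epsilon>"
    using ev1 ev2
  proof eventually_elim
    case (elim k)
    have "\<epsilon> = 8 * e" by (simp add: e_def)
    thus ?case using elim nu[of k] mu Cm e by linarith
  qed
  thus "\<exists>k0. \<forall>k\<ge>k0. norm ((\<integral>x. f x \<partial>\<nu> k) - (\<integral>x. f x \<partial>\<mu>)) < \<epsilon>"
    by (simp add: eventually_sequentially)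
qed

subsection \<open>Orthogonal polynomials of the limit distribution\<close>

definition limit_coeff :: "real \<Rightarrow> nat \<Rightarrow> real" where
  "limit_coeff y s = (if s = 1 then 1 else if even s then 1 / y else 1)"

text \<open>The monic orthogonal polynomials of the absolutely continuous part, given by the limit
  of the walk recursion.\<close>

fun limit_poly :: "real \<Rightarrow> nat \<Rightarrow> real \<Rightarrow> real" where
  "limit_poly y 0 x = 1"
| "limit_poly y (Suc 0) x = x"
| "limit_poly y (Suc (Suc s)) x = x * limit_poly y (Suc s) x - limit_coeff y (Suc s) * limit_poly y s x"

text \<open>\<open>jacobi_expansion\<close> on a one-point set: the same coefficients that govern
  walks express monomials in the orthogonal polynomials.\<close>

lemma power_eq_sum_limit_poly:
  "x ^ j = (\<Sum>s\<le>j. jacobi_coeff (limit_coeff y) j s * limit_poly y s x)"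
proof -
  let ?K = "\<lambda>_ _ :: unit. x"
  have "(kernel_apply {()} ?K ^^ j) (\<lambda>_. limit_poly y 0 x) ()
      = (\<Sum>s\<le>j. jacobi_coeff (limit_coeff y) j s * limit_poly y s x)"
    by (rule jacobi_expansion[where p = "\<lambda>s _. limit_poly y s x"]) (auto simp: kernel_apply_def)
  moreover have "(kernel_apply {()} ?K ^^ j) (\<lambda>_. limit_poly y 0 x) () = x ^ j"
    by (induction j) (auto simp: kernel_apply_def)
  ultimately show ?thesis by simp
qed

lemma limit_poly_minus: "limit_poly y s (- x) = (- 1) ^ s * limit_poly y s x"
  by (induction y s x rule: limit_poly.induct) (auto simp: algebra_simps)

lemma continuous_on_limit_poly [continuous_intros]: "continuous_on S (limit_poly y s)"
proof -
  have "continuous_on S (\<lambda>x. limit_poly y s x)"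
    by (induction y s "0 :: real" rule: limit_poly.induct) (auto intro!: continuous_intros)
  thus ?thesis by simp
qed

text \<open>Two steps of the recursion multiply by x^2 - 1 - r^2 = 2 r cos \<theta>, which is the
  Chebyshev recursion up to scaling. With U_k = sin ((k + 1) \<theta>) / sin \<theta> the
  polynomials are r^k (U_k + r U_(k-1)) and x r^k U_k; the factor sin \<theta> is kept on the left
  so that no division occurs.\<close>

lemma limit_poly_trig:
  assumes y: "1 / y = r\<^sup>2" and x: "x\<^sup>2 = 1 + r\<^sup>2 + 2 * r * cos \<theta>"
  shows "sin \<theta> * limit_poly y (2 * k) x = r ^ k * (sin (real (Suc k) * \<theta>) + r * sin (real k * \<theta>)) \<and>
    sin \<theta> * limit_poly y (Suc (2 * k)) x = x * r ^ k * sin (real (Suc k) * \<theta>)"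
proof (induction k)
  case (Suc k)
  let ?s = "\<lambda>k. sin (real k * \<theta>)" and ?p = "\<lambda>s. limit_poly y s x"
  have add: "?s (Suc (Suc k)) = 2 * cos \<theta> * ?s (Suc k) - ?s k"
  proof -
    have "?s (Suc (Suc k)) = sin (real (Suc k) * \<theta> + \<theta>)" "?s k = sin (real (Suc k) * \<theta> - \<theta>)"
      by (simp_all add: algebra_simps)
    thus ?thesis by (simp only: sin_add sin_diff) (simp add: algebra_simps)
  qed
  have IH1: "sin \<theta> * ?p (2 * k) = r ^ k * (?s (Suc k) + r * ?s k)"
    and IH2: "sin \<theta> * ?p (Suc (2 * k)) = x * r ^ k * ?s (Suc k)" using Suc by auto
  have "?p (2 * Suc k) = x * ?p (Suc (2 * k)) - ?p (2 * k)" by (simp add: limit_coeff_def)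
  hence "sin \<theta> * ?p (2 * Suc k) = x * (sin \<theta> * ?p (Suc (2 * k))) - sin \<theta> * ?p (2 * k)"
    by (simp add: algebra_simps)
  also have "\<dots> = x\<^sup>2 * r ^ k * ?s (Suc k) - r ^ k * (?s (Suc k) + r * ?s k)"
    by (simp only: IH1 IH2) (simp add: power2_eq_square)
  also have "\<dots> = r ^ Suc k * (?s (Suc (Suc k)) + r * ?s (Suc k))"
    unfolding x add by (simp add: algebra_simps power2_eq_square)
  finally have 1: "sin \<theta> * ?p (2 * Suc k) = r ^ Suc k * (?s (Suc (Suc k)) + r * ?s (Suc k))" .
  have "?p (Suc (2 * Suc k)) = x * ?p (2 * Suc k) - r\<^sup>2 * ?p (Suc (2 * k))"
    by (simp add: limit_coeff_def y)
  hence "sin \<theta> * ?p (Suc (2 * Suc k)) = x * (sin \<theta> * ?p (2 * Suc k)) - r\<^sup>2 * (sin \<theta> * ?p (Suc (2 * k)))"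
    by (simp only: right_diff_distrib mult.left_commute)
  also have "\<dots> = x * r ^ Suc k * ?s (Suc (Suc k))"
    by (simp only: 1 IH2) (simp add: algebra_simps power2_eq_square)
  finally show ?case using 1 by simp
qed simp

section \<open>Integrals in the angle\<close>

lemma denominator_pos:
  fixes r :: real
  assumes "0 < r" "r \<le> 1" "0 < \<theta>" "\<theta> < pi"
  shows "0 < 1 + r\<^sup>2 + 2 * r * cos \<theta>"
proof -
  have "cos pi < cos \<theta>" using assms by (intro cos_monotone_0_pi) auto
  hence "2 * r * (- 1) < 2 * r * cos \<theta>" using assms by (intro mult_strict_left_mono) auto
  moreover have "0 \<le> (1 - r)\<^sup>2" by simp
  ultimately show ?thesis by (simp add: power2_eq_square algebra_simps)
qed

text \<open>Orthogonality of the sines on (0, pi), in terms of primitives. The product formula gives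
  the difference of two cosines; for s = 0 one of them is constant, whence the separate
  primitive.\<close>

lemma antiderivative_sin_sin:
  "\<exists>\<Psi>. continuous_on UNIV \<Psi> \<and> (\<forall>\<theta>. (\<Psi> has_real_derivative sin \<theta> * sin (real (Suc s) * \<theta>)) (at \<theta>)) \<and>
     \<Psi> pi - \<Psi> 0 = (if s = 0 then pi / 2 else 0)"
proof (cases "s = 0")
  case True
  have "((\<lambda>\<theta>. (\<theta> - sin \<theta> * cos \<theta>) / 2) has_real_derivative sin \<theta> * sin (real (Suc s) * \<theta>)) (at \<theta>)" for \<theta>
  proof -
    have "(1 - (cos \<theta> * cos \<theta> - sin \<theta> * sin \<theta>)) / 2 = sin \<theta> * sin \<theta>"
      using sin_squared_eq[of \<theta>] by (simp add: power2_eq_square)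
    moreover have "((\<lambda>\<theta>. (\<theta> - sin \<theta> * cos \<theta>) / 2) has_real_derivative
        (1 - (cos \<theta> * cos \<theta> - sin \<theta> * sin \<theta>)) / 2) (at \<theta>)"
      by (auto intro!: derivative_eq_intros)
    ultimately have "((\<lambda>\<theta>. (\<theta> - sin \<theta> * cos \<theta>) / 2) has_real_derivative sin \<theta> * sin \<theta>) (at \<theta>)"
      by (simp only:)
    thus ?thesis using True by simp
  qed
  thus ?thesis using True
    by (intro exI[of _ "\<lambda>\<theta>. (\<theta> - sin \<theta> * cos \<theta>) / 2"]) (auto intro!: continuous_intros)
next
  case False
  let ?\<Psi> = "\<lambda>\<theta>. (sin (real s * \<theta>) / real s - sin (real (Suc (Suc s)) * \<theta>) / real (Suc (Suc s))) / 2"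
  have "(?\<Psi> has_real_derivative sin \<theta> * sin (real (Suc s) * \<theta>)) (at \<theta>)" for \<theta>
  proof -
    have "real s * \<theta> = real (Suc s) * \<theta> - \<theta>" "real (Suc (Suc s)) * \<theta> = real (Suc s) * \<theta> + \<theta>"
      by (simp_all add: algebra_simps)
    hence "(cos (real s * \<theta>) - cos (real (Suc (Suc s)) * \<theta>)) / 2 = sin \<theta> * sin (real (Suc s) * \<theta>)"
      by (simp only: cos_add cos_diff) (simp add: algebra_simps)
    moreover have "(?\<Psi> has_real_derivative (cos (real s * \<theta>) - cos (real (Suc (Suc s)) * \<theta>)) / 2) (at \<theta>)"
      using False by (auto intro!: derivative_eq_intros)
    ultimately show ?thesis by simp
  qed
  moreover have "sin (real k * pi) = 0" for k by (rule sin_npi)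
  ultimately show ?thesis using False
    by (intro exI[of _ ?\<Psi>]) (auto intro!: continuous_intros simp del: of_nat_Suc)
qed

text \<open>Up to the factor 2 r^s / ((1 + y) pi), the product of
  \<open>limit_poly y (2 * s)\<close> and the limit density after the substitution x^2 = 1 + r^2 + 2
  r cos \<theta>.\<close>

definition arc_integrand :: "real \<Rightarrow> nat \<Rightarrow> real \<Rightarrow> real" where
  "arc_integrand r s \<theta> = sin \<theta> * (sin (real (Suc s) * \<theta>) + r * sin (real s * \<theta>)) /
     (1 + r\<^sup>2 + 2 * r * cos \<theta>)"

text \<open>In this combination the sine addition formula makes the numerator a multiple of the
  denominator, so only a product of sines remains.\<close>

lemma arc_integrand_Suc:
  assumes "0 < 1 + r\<^sup>2 + 2 * r * cos \<theta>"
  shows "arc_integrand r s \<theta> + r * arc_integrand r (Suc s) \<theta> = sin \<theta> * sin (real (Suc s) * \<theta>)"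
proof -
  let ?s = "\<lambda>k. sin (real k * \<theta>)" and ?D = "1 + r\<^sup>2 + 2 * r * cos \<theta>"
  have add: "?s (Suc (Suc s)) = 2 * cos \<theta> * ?s (Suc s) - ?s s"
  proof -
    have "?s (Suc (Suc s)) = sin (real (Suc s) * \<theta> + \<theta>)" "?s s = sin (real (Suc s) * \<theta> - \<theta>)"
      by (simp_all add: algebra_simps)
    thus ?thesis by (simp only: sin_add sin_diff) (simp add: algebra_simps)
  qed
  have "arc_integrand r s \<theta> + r * arc_integrand r (Suc s) \<theta>
      = sin \<theta> * (?s (Suc s) + r * ?s s + r * (?s (Suc (Suc s)) + r * ?s (Suc s))) / ?D"
    unfolding arc_integrand_def by (simp only: add_divide_distrib times_divide_eq_right distrib_left) (simp add: mult_ac)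
  also have "?s (Suc s) + r * ?s s + r * (?s (Suc (Suc s)) + r * ?s (Suc s)) = ?s (Suc s) * ?D"
    unfolding add by (simp add: algebra_simps power2_eq_square)
  finally show ?thesis using assms by simp
qed

text \<open>The value \<open>pi / 2\<close> for \<open>s = 0\<close> comes from an explicit primitive; the others vanish because
  of \<open>arc_integrand_Suc\<close>. Working with primitives that are merely continuous at \<open>0\<close> and \<open>pi\<close> avoids
  the pole of the denominator at \<open>pi\<close> in the case \<open>r = 1\<close>.\<close>

lemma antiderivative_arc_integrand:
  assumes r: "0 < r" "r \<le> 1"
  shows "\<exists>\<Phi>. continuous_on {0..pi} \<Phi> \<and>
     (\<forall>\<theta>\<in>{0<..<pi}. (\<Phi> has_real_derivative arc_integrand r s \<theta>) (at \<theta>)) \<and>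
     \<Phi> pi - \<Phi> 0 = (if s = 0 then pi / 2 else 0)"
proof (induction s)
  case 0
  show ?case
  proof (cases "r = 1")
    case True
    \<comment> \<open>For r = 1 the integrand is sin^2 / (2 (1 + cos)) = (1 - cos) / 2. The general
      primitive below has \<gamma> = 0 here, but the argument of its arctan blows up at pi.\<close>
    let ?\<Phi> = "\<lambda>\<theta>. \<theta> / 2 - sin \<theta> / 2"
    have "(?\<Phi> has_real_derivative arc_integrand r 0 \<theta>) (at \<theta>)" if "\<theta> \<in> {0<..<pi}" for \<theta>
    proof -
      have "0 < 1 + 1\<^sup>2 + 2 * 1 * cos \<theta>" using that by (intro denominator_pos) auto
      hence "1 + cos \<theta> \<noteq> 0" by simp
      moreover have "sin \<theta> * sin \<theta> = (1 + cos \<theta>) * (1 - cos \<theta>)"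
        using sin_squared_eq[of \<theta>] by (simp add: power2_eq_square algebra_simps)
      moreover have "arc_integrand r 0 \<theta> = sin \<theta> * sin \<theta> / ((1 + cos \<theta>) * 2)"
        by (simp add: arc_integrand_def True)
      ultimately have "arc_integrand r 0 \<theta> = (1 - cos \<theta>) / 2"
        by (simp only: mult_divide_mult_cancel_left_if if_False)
      thus ?thesis by (auto intro!: derivative_eq_intros simp: field_simps)
    qed
    thus ?thesis by (intro exI[of _ ?\<Phi>]) (auto intro!: continuous_intros)
  next
    case False
    hence r1: "r < 1" using r by simp
    have pos: "0 < 1 + r * cos \<theta>" for \<theta>
    proof -
      have "r * (- 1) \<le> r * cos \<theta>" using r by (intro mult_left_mono) auto
      thus ?thesis using r1 by linarith
    qed
    \<comment> \<open>The arctan is the argument of 1 + r exp(i \<theta>), with derivative (r cos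
      \<theta> + r^2) / D, where D is the denominator of the integrand. The coefficients come from
      writing sin^2 = 1 - cos^2 as (1/2 - cos / (2 r)) D + \<gamma> (r cos + r^2). At 0 and pi only
      the term \<theta> / 2 differs.\<close>
    define \<gamma> where "\<gamma> = (1 - r\<^sup>2) / (2 * r\<^sup>2)"
    let ?\<Phi> = "\<lambda>\<theta>. \<theta> / 2 - sin \<theta> / (2 * r) + \<gamma> * arctan (r * sin \<theta> / (1 + r * cos \<theta>))"
    have "(?\<Phi> has_real_derivative arc_integrand r 0 \<theta>) (at \<theta>)" if "\<theta> \<in> {0<..<pi}" for \<theta>
    proof -
      define c S where "c = cos \<theta>" and "S = sin \<theta>"
      let ?D = "1 + r\<^sup>2 + 2 * r * c" and ?E = "1 + r * c"
      have D: "0 < ?D" unfolding c_def using r that by (intro denominator_pos) auto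
      have E: "0 < ?E" unfolding c_def by (rule pos)
      have SS: "S * S = 1 - c * c" using sin_squared_eq[of \<theta>] by (simp add: c_def S_def power2_eq_square)
      have u': "((\<lambda>\<theta>. r * sin \<theta> / (1 + r * cos \<theta>)) has_real_derivative (r * c + r\<^sup>2) / ?E\<^sup>2) (at \<theta>)"
      proof -
        have "r * c * ?E + (r * r) * (S * S) = r * c + r\<^sup>2"
          unfolding SS by (simp add: algebra_simps power2_eq_square)
        moreover have "((\<lambda>\<theta>. r * sin \<theta> / (1 + r * cos \<theta>)) has_real_derivative
            (r * c * ?E + (r * r) * (S * S)) / ?E\<^sup>2) (at \<theta>)"
          using E unfolding c_def S_def
          by (auto intro!: derivative_eq_intros simp: power2_eq_square mult_ac)
        ultimately show ?thesis by simp
      qed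
      have "1 + (r * S / ?E)\<^sup>2 = (?E\<^sup>2 + r\<^sup>2 * (S * S)) / ?E\<^sup>2"
        using E by (simp add: power_divide power_mult_distrib add_divide_distrib power2_eq_square)
      also have "?E\<^sup>2 + r\<^sup>2 * (S * S) = ?D"
        unfolding SS by (simp add: algebra_simps power2_eq_square)
      finally have arc: "inverse (1 + (r * S / ?E)\<^sup>2) * ((r * c + r\<^sup>2) / ?E\<^sup>2) = (r * c + r\<^sup>2) / ?D"
        using E D by simp
      have "((\<lambda>\<theta>. arctan (r * sin \<theta> / (1 + r * cos \<theta>))) has_real_derivative
          inverse (1 + (r * S / ?E)\<^sup>2) * ((r * c + r\<^sup>2) / ?E\<^sup>2)) (at \<theta>)"
        unfolding c_def S_def by (rule DERIV_chain2[OF DERIV_arctan u'[unfolded c_def]])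
      hence "((\<lambda>\<theta>. arctan (r * sin \<theta> / (1 + r * cos \<theta>))) has_real_derivative (r * c + r\<^sup>2) / ?D) (at \<theta>)"
        unfolding arc .
      hence "(?\<Phi> has_real_derivative 1 / 2 - c / (2 * r) + \<gamma> * ((r * c + r\<^sup>2) / ?D)) (at \<theta>)"
        unfolding c_def by (intro DERIV_add DERIV_diff DERIV_cmult DERIV_cdivide DERIV_ident DERIV_sin)
      moreover have "1 / 2 - c / (2 * r) + \<gamma> * ((r * c + r\<^sup>2) / ?D) = arc_integrand r 0 \<theta>"
      proof -
        have "(1 / 2 - c / (2 * r)) * ?D + \<gamma> * (r * c + r\<^sup>2) = S * S"
          unfolding SS \<gamma>_def using r by (simp add: field_simps power2_eq_square)
        hence "((1 / 2 - c / (2 * r)) * ?D + \<gamma> * (r * c + r\<^sup>2)) / ?D = S * S / ?D" by simp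
        moreover have "((1 / 2 - c / (2 * r)) * ?D + \<gamma> * (r * c + r\<^sup>2)) / ?D
            = 1 / 2 - c / (2 * r) + \<gamma> * ((r * c + r\<^sup>2) / ?D)"
          unfolding add_divide_distrib[of "(1 / 2 - c / (2 * r)) * ?D"] using D by simp
        ultimately have "1 / 2 - c / (2 * r) + \<gamma> * ((r * c + r\<^sup>2) / ?D) = S * S / ?D" by (simp only:)
        thus ?thesis by (simp add: arc_integrand_def c_def S_def)
      qed
      ultimately show ?thesis by simp
    qed
    moreover have "continuous_on {0..pi} ?\<Phi>"
      using pos by (intro continuous_intros) (auto simp: less_imp_neq[symmetric] r less_imp_neq)
    ultimately show ?thesis by (intro exI[of _ ?\<Phi>]) auto
  qed
next
  case (Suc s)
  then obtain \<Phi> where \<Phi>: "continuous_on {0..pi} \<Phi>"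
    "\<And>\<theta>. \<theta> \<in> {0<..<pi} \<Longrightarrow> (\<Phi> has_real_derivative arc_integrand r s \<theta>) (at \<theta>)"
    "\<Phi> pi - \<Phi> 0 = (if s = 0 then pi / 2 else 0)" by blast
  obtain \<Psi> where \<Psi>: "continuous_on UNIV \<Psi>"
    "\<And>\<theta>. (\<Psi> has_real_derivative sin \<theta> * sin (real (Suc s) * \<theta>)) (at \<theta>)"
    "\<Psi> pi - \<Psi> 0 = (if s = 0 then pi / 2 else 0)"
    using antiderivative_sin_sin[of s] by blast
  \<comment> \<open>\<open>arc_integrand_Suc\<close> solved for its second term. For s = 0 the two
    increments pi / 2 cancel; for s > 0 both are 0.\<close>
  let ?X = "\<lambda>\<theta>. (\<Psi> \<theta> - \<Phi> \<theta>) / r"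
  have "(?X has_real_derivative arc_integrand r (Suc s) \<theta>) (at \<theta>)" if \<theta>: "\<theta> \<in> {0<..<pi}" for \<theta>
  proof -
    have "0 < 1 + r\<^sup>2 + 2 * r * cos \<theta>" using r \<theta> by (intro denominator_pos) auto
    from arc_integrand_Suc[OF this, of s]
    have "(sin \<theta> * sin (real (Suc s) * \<theta>) - arc_integrand r s \<theta>) / r = arc_integrand r (Suc s) \<theta>"
      using r by (simp add: field_simps)
    thus ?thesis using DERIV_cdivide[OF DERIV_diff[OF \<Psi>(2)[of \<theta>] \<Phi>(2)[OF \<theta>]], of r] by simp
  qed
  moreover have "continuous_on {0..pi} ?X"
    using r \<Phi>(1) continuous_on_subset[OF \<Psi>(1)] by (intro continuous_intros) auto
  moreover have "?X pi - ?X 0 = ((\<Psi> pi - \<Psi> 0) - (\<Phi> pi - \<Phi> 0)) / r" by (simp add: diff_divide_distrib)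
  ultimately show ?case using \<Phi>(3) \<Psi>(3) by (intro exI[of _ ?X]) auto
qed

text \<open>The substitution is carried out on the primitive, which is continuous on the closed
  interval and differentiable inside; this is all that the fundamental theorem asks for, although
  arccos is not differentiable at the edges.\<close>

lemma has_integral_limit_poly_density:
  assumes y: "1 \<le> y"
  shows "((\<lambda>x. limit_poly y (2 * s) x * limit_density y x) has_integral
    (if s = 0 then 1 / (1 + y) else 0)) {lower_edge y..upper_edge y}"
proof -
  define r where "r = y powr (- 1 / 2)"
  have r0: "0 < r" using y by (simp add: r_def)
  have r2: "r\<^sup>2 = 1 / y"
  proof -
    have "r\<^sup>2 = y powr (- 1 / 2 + - 1 / 2)"
      unfolding power2_eq_square r_def by (rule powr_add[symmetric])
    also have "- 1 / 2 + - 1 / 2 = (- 1 :: real)" by simp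
    finally show ?thesis using y by (simp add: powr_minus_divide)
  qed
  have "r \<le> y powr 0" unfolding r_def using y by (intro powr_mono) auto
  hence r1: "r \<le> 1" using y by simp
  have ab: "lower_edge y = 1 - r" "upper_edge y = 1 + r" by (simp_all add: lower_edge_def upper_edge_def r_def)
  obtain \<Phi> where \<Phi>: "continuous_on {0..pi} \<Phi>"
    "\<And>\<theta>. \<theta> \<in> {0<..<pi} \<Longrightarrow> (\<Phi> has_real_derivative arc_integrand r s \<theta>) (at \<theta>)"
    "\<Phi> pi - \<Phi> 0 = (if s = 0 then pi / 2 else 0)"
    using antiderivative_arc_integrand[OF r0 r1, of s] by blast
  \<comment> \<open>\<open>c x\<close> is cos \<theta> solved from the substitution. The constant
    \<open>C\<close> below is negative because \<theta> decreases from pi to 0 as x runs from the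
    lower to the upper edge.\<close>
  define c where "c x = (x\<^sup>2 - 1 - r\<^sup>2) / (2 * r)" for x
  define C where "C = - 2 * r ^ s / ((1 + y) * pi)"
  let ?F = "\<lambda>x. C * \<Phi> (arccos (c x))"
  have cab: "c (1 - r) = - 1" "c (1 + r) = 1"
    using r0 by (simp_all add: c_def power2_eq_square field_simps)
  have cmono: "c x < c x'" if "0 \<le> x" "x < x'" for x x'
    using that r0 power_strict_mono[of x x' 2] by (simp add: c_def divide_strict_right_mono)
  have crange: "c x \<in> {-1..1}" if "x \<in> {1 - r..1 + r}" for x
    using cmono[of "1 - r" x] cmono[of x "1 + r"] that r1 cab
    by (cases "x = 1 - r"; cases "x = 1 + r") auto
  have "continuous_on {1 - r..1 + r} (\<lambda>x. arccos (c x))"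
    unfolding c_def using r0 crange unfolding c_def by (intro continuous_intros) auto
  moreover have "(\<lambda>x. arccos (c x)) ` {1 - r..1 + r} \<subseteq> {0..pi}"
    using crange arccos_lbound arccos_ubound by (simp add: image_subset_iff)
  ultimately have cont: "continuous_on {1 - r..1 + r} ?F"
    by (intro continuous_on_mult continuous_on_const continuous_on_compose2[OF \<Phi>(1)])
  have deriv: "(?F has_vector_derivative limit_poly y (2 * s) x * limit_density y x) (at x)"
    if x: "x \<in> {1 - r<..<1 + r}" for x
  proof -
    have x0: "0 < x" using x r1 by auto
    define \<theta> where "\<theta> = arccos (c x)"
    have cx: "- 1 < c x" "c x < 1" using cmono[of "1 - r" x] cmono[of x "1 + r"] x r1 cab by auto
    have \<theta>: "0 < \<theta>" "\<theta> < pi" using arccos_lt_bounded[OF cx] by (simp_all add: \<theta>_def)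
    have cos\<theta>: "cos \<theta> = c x" using cx by (simp add: \<theta>_def)
    have sin\<theta>: "0 < sin \<theta>" using \<theta> by (simp add: sin_gt_zero)
    have x2: "x\<^sup>2 = 1 + r\<^sup>2 + 2 * r * cos \<theta>" using r0 by (simp add: cos\<theta> c_def)
    have "sin \<theta> = sqrt (1 - (c x)\<^sup>2)" using cx by (simp add: \<theta>_def sin_arccos)
    hence acos: "(arccos has_real_derivative inverse (- sin \<theta>)) (at (c x))"
      using DERIV_arccos[OF cx] by simp
    have "(c has_real_derivative x / r) (at x)"
      unfolding c_def using r0 by (auto intro!: derivative_eq_intros)
    from DERIV_chain2[OF acos this]
    have "((\<lambda>x. arccos (c x)) has_real_derivative inverse (- sin \<theta>) * (x / r)) (at x)" .
    moreover have "(\<Phi> has_real_derivative arc_integrand r s \<theta>) (at (arccos (c x)))"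
      using \<Phi>(2)[of \<theta>] \<theta> by (simp add: \<theta>_def)
    ultimately have "((\<lambda>x. \<Phi> (arccos (c x))) has_real_derivative
        arc_integrand r s \<theta> * (inverse (- sin \<theta>) * (x / r))) (at x)"
      by (intro DERIV_chain2[of \<Phi>])
    hence F: "(?F has_real_derivative C * (arc_integrand r s \<theta> * (inverse (- sin \<theta>) * (x / r)))) (at x)"
      by (intro DERIV_cmult)
    define q where "q = sin (real (Suc s) * \<theta>) + r * sin (real s * \<theta>)"
    have "arc_integrand r s \<theta> * (inverse (- sin \<theta>) * (x / r)) = - q / (r * x)"
      unfolding arc_integrand_def x2[symmetric] q_def[symmetric] using sin\<theta> x0 r0
      by (simp add: field_simps power2_eq_square)
    hence "C * (arc_integrand r s \<theta> * (inverse (- sin \<theta>) * (x / r))) = 2 * r ^ s * q / ((1 + y) * pi * r * x)"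
      by (simp only: C_def) (simp add: mult_ac)
    also have "\<dots> = limit_poly y (2 * s) x * limit_density y x"
    proof -
      have "(upper_edge y)\<^sup>2 - x\<^sup>2 = 2 * r * (1 - cos \<theta>)" "x\<^sup>2 - (lower_edge y)\<^sup>2 = 2 * r * (1 + cos \<theta>)"
        unfolding x2 ab by (simp_all add: power2_eq_square algebra_simps)
      hence "((upper_edge y)\<^sup>2 - x\<^sup>2) * (x\<^sup>2 - (lower_edge y)\<^sup>2) = (2 * r)\<^sup>2 * (1 - (cos \<theta>)\<^sup>2)"
        by (simp add: power2_eq_square algebra_simps)
      also have "1 - (cos \<theta>)\<^sup>2 = (sin \<theta>)\<^sup>2" by (simp add: sin_squared_eq)
      finally have "sqrt (((upper_edge y)\<^sup>2 - x\<^sup>2) * (x\<^sup>2 - (lower_edge y)\<^sup>2)) = 2 * r * sin \<theta>"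
        using r0 sin\<theta> by (simp add: real_sqrt_mult)
      hence "limit_density y x = y / ((1 + y) * pi * x) * (2 * r * sin \<theta>)"
        unfolding limit_density_eq using x0 by simp
      hence "limit_poly y (2 * s) x * limit_density y x
          = y / ((1 + y) * pi * x) * (2 * r) * (sin \<theta> * limit_poly y (2 * s) x)" by simp
      also have "sin \<theta> * limit_poly y (2 * s) x = r ^ s * q"
        using limit_poly_trig[of y r x \<theta> s] r2 x2 by (simp add: q_def)
      also have "y / ((1 + y) * pi * x) * (2 * r) * (r ^ s * q) = (y * r\<^sup>2) * (2 * r ^ s * q) / ((1 + y) * pi * r * x)"
        using r0 by (simp add: power2_eq_square mult_ac)
      also have "y * r\<^sup>2 = 1" using r2 y by simp
      finally show ?thesis by simp
    qed
    finally show ?thesis using F by (simp add: has_real_derivative_iff_has_vector_derivative)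
  qed
  have "((\<lambda>x. limit_poly y (2 * s) x * limit_density y x) has_integral
      (?F (1 + r) - ?F (1 - r))) {1 - r..1 + r}"
    by (rule fundamental_theorem_of_calculus_interior[OF _ cont deriv]) (use r0 in auto)
  moreover have "?F (1 + r) - ?F (1 - r) = - C * (\<Phi> pi - \<Phi> 0)" by (simp add: cab algebra_simps)
  moreover have "\<dots> = (if s = 0 then 1 / (1 + y) else 0)" by (simp add: \<Phi>(3) C_def)
  ultimately show ?thesis by (simp only: ab)
qed

subsection \<open>Moments of the limit distribution\<close>

context
  fixes y :: real
  assumes y: "1 \<le> y"
begin

lemma lower_edge_nonneg: "0 \<le> lower_edge y"
  and edges_le: "lower_edge y \<le> upper_edge y"
  and upper_edge_le_2: "upper_edge y \<le> 2"
proof -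
  have "y powr (- 1 / 2) \<le> y powr 0" using y by (intro powr_mono) auto
  hence "y powr (- 1 / 2) \<le> 1" using y by simp
  moreover have "0 \<le> y powr (- 1 / 2)" by simp
  ultimately show "0 \<le> lower_edge y" "lower_edge y \<le> upper_edge y" "upper_edge y \<le> 2"
    by (simp_all add: lower_edge_def upper_edge_def)
qed

text \<open>The part of the density on the positive side. The full density is its symmetrisation, so
  all integrals reduce to one interval and odd polynomials drop out.\<close>

definition half_density :: "real \<Rightarrow> real" where
  "half_density x = limit_density y x * indicator {lower_edge y..upper_edge y} x"

lemma limit_density_minus: "limit_density y (- x) = limit_density y x"
  by (simp add: limit_density_def)

lemma half_density_nonneg: "0 \<le> half_density x"
proof (cases "x \<in> {lower_edge y..upper_edge y}")
  case True
  hence "(lower_edge y)\<^sup>2 \<le> x\<^sup>2" "x\<^sup>2 \<le> (upper_edge y)\<^sup>2"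
    using lower_edge_nonneg by (auto intro!: power_mono)
  thus ?thesis using True y by (simp add: half_density_def limit_density_eq)
qed (simp add: half_density_def)

lemma half_density_measurable [measurable]: "half_density \<in> borel_measurable borel"
  unfolding half_density_def by measurable

text \<open>The two halves of the support overlap in \<open>0\<close> if \<open>y = 1\<close>, but \<open>limit_density 1 0 = 0\<close>.\<close>

lemma limit_density_halves:
  "limit_density y x * indicator (limit_support y) x = half_density x + half_density (- x)"
proof (cases "x = 0")
  case True
  have "limit_density y 0 = 0" by (simp add: limit_density_def)
  thus ?thesis using True by (simp add: half_density_def)
next
  case False
  thus ?thesis
    using lower_edge_nonneg edges_le
    by (auto simp: half_density_def limit_support_def limit_density_minus indicator_def)
qed

lemma has_integral_half_density:
  "((\<lambda>x. limit_poly y (2 * s) x * half_density x) has_integral (if s = 0 then 1 / (1 + y) else 0)) UNIV"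
proof -
  have "((\<lambda>x. if x \<in> {lower_edge y..upper_edge y} then limit_poly y (2 * s) x * limit_density y x else 0)
      has_integral (if s = 0 then 1 / (1 + y) else 0)) UNIV"
    using has_integral_limit_poly_density[OF y, of s] by (simp only: has_integral_restrict_UNIV)
  moreover have "(\<lambda>x. if x \<in> {lower_edge y..upper_edge y} then limit_poly y (2 * s) x * limit_density y x else 0)
      = (\<lambda>x. limit_poly y (2 * s) x * half_density x)"
    by (auto simp: half_density_def indicator_def)
  ultimately show ?thesis by simp
qed

text \<open>The gauge integral of the case s = 0 is finite and the function nonnegative, hence it is
  Lebesgue integrable.\<close>

lemma integrable_half_density: "integrable lborel half_density"
proof (rule integrableI_nonneg)
  have "(half_density has_integral 1 / (1 + y)) UNIV"
    using has_integral_half_density[of 0] by simp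
  hence "(\<integral>\<^sup>+x. ennreal (half_density x) \<partial>lborel) = ennreal (1 / (1 + y))"
    using half_density_nonneg by (intro nn_integral_has_integral_lborel) auto
  thus "(\<integral>\<^sup>+x. ennreal (half_density x) \<partial>lborel) < \<infinity>" by simp
qed (auto simp: half_density_nonneg)

lemma integrable_mult_half_density:
  fixes f :: "real \<Rightarrow> real"
  assumes f: "continuous_on UNIV f"
  shows "integrable lborel (\<lambda>x. f x * half_density x)"
proof -
  have [measurable]: "f \<in> borel_measurable borel" using f by (rule borel_measurable_continuous_onI)
  have "compact (f ` {lower_edge y..upper_edge y})"
    using f by (intro compact_continuous_image) (auto intro: continuous_on_subset)
  then obtain C where "\<forall>z\<in>f ` {lower_edge y..upper_edge y}. norm z \<le> C"
    using compact_imp_bounded bounded_iff by metis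
  hence C: "\<bar>f x\<bar> \<le> C" if "x \<in> {lower_edge y..upper_edge y}" for x
    using that by auto
  have le: "\<bar>f x * half_density x\<bar> \<le> \<bar>C * half_density x\<bar>" for x
  proof (cases "x \<in> {lower_edge y..upper_edge y}")
    case True
    thus ?thesis using C[OF True] unfolding abs_mult by (intro mult_right_mono) auto
  qed (simp add: half_density_def)
  show ?thesis
    by (rule Bochner_Integration.integrable_bound[OF integrable_mult_right[OF integrable_half_density, of C]])
      (use le in auto)
qed

definition ac_part :: "real measure" where
  "ac_part = density lborel (\<lambda>x. ennreal (limit_density y x * indicator (limit_support y) x))"

lemma sets_ac_part [simp]: "sets ac_part = sets borel"
  by (simp add: ac_part_def)

lemma emeasure_limit_measure_ac:
  "B \<in> sets borel \<Longrightarrow> emeasure (limit_measure y) B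
     = emeasure ac_part B + ennreal ((y - 1) / (y + 1)) * indicator B 0"
  unfolding emeasure_limit_measure ac_part_def
  by (subst emeasure_density) (auto intro!: nn_integral_cong simp: limit_support_def indicator_def)

lemma integral_ac_part:
  fixes f :: "real \<Rightarrow> real"
  assumes f: "continuous_on UNIV f"
  shows "integrable ac_part f"
    and "(\<integral>x. f x \<partial>ac_part) = (\<integral>x. f x * half_density x \<partial>lborel) + (\<integral>x. f (- x) * half_density x \<partial>lborel)"
proof -
  have [measurable]: "f \<in> borel_measurable borel" using f by (rule borel_measurable_continuous_onI)
  have fm: "continuous_on UNIV (\<lambda>x. f (- x))"
    by (intro continuous_on_compose2[OF f]) (auto intro: continuous_intros)
  have nn: "0 \<le> limit_density y x * indicator (limit_support y) x" for x
    unfolding limit_density_halves using half_density_nonneg[of x] half_density_nonneg[of "- x"] by simp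
  have [measurable]: "limit_support y \<in> sets borel" by (simp add: limit_support_def)
  have eq: "(limit_density y x * indicator (limit_support y) x) *\<^sub>R f x
      = f x * half_density x + f (- (- x)) * half_density (- x)" for x
    unfolding limit_density_halves by (simp add: algebra_simps)
  note i1 = integrable_mult_half_density[OF f]
  note i2 = integrable_mult_half_density[OF fm]
  have i3: "integrable lborel (\<lambda>x. f (- (- x)) * half_density (- x))"
    using lborel_integrable_real_affine[OF i2, of "- 1" 0] by simp
  have i4: "(\<integral>x. f (- (- x)) * half_density (- x) \<partial>lborel) = (\<integral>x. f (- x) * half_density x \<partial>lborel)"
    using lborel_integral_real_affine[of "- 1" "\<lambda>x. f (- x) * half_density x" 0] by simp
  show "integrable ac_part f"
    unfolding ac_part_def using nn i1 i3
    by (subst integrable_density) (auto simp only: eq intro!: Bochner_Integration.integrable_add, auto)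
  show "(\<integral>x. f x \<partial>ac_part) = (\<integral>x. f x * half_density x \<partial>lborel) + (\<integral>x. f (- x) * half_density x \<partial>lborel)"
    unfolding ac_part_def using nn
    by (subst integral_density)
      (auto simp only: eq Bochner_Integration.integral_add[OF i1 i3] i4, auto)
qed

lemma integral_ac_part_limit_poly:
  "(\<integral>x. limit_poly y s x \<partial>ac_part) = (if s = 0 then 2 / (1 + y) else 0)"
proof -
  have *: "(\<integral>x. limit_poly y s x \<partial>ac_part)
      = (1 + (- 1) ^ s) * (\<integral>x. limit_poly y s x * half_density x \<partial>lborel)"
  proof -
    have "(\<lambda>x. limit_poly y s (- x) * half_density x) = (\<lambda>x. (- 1) ^ s * (limit_poly y s x * half_density x))"
      by (simp add: limit_poly_minus mult.assoc)
    hence "(\<integral>x. limit_poly y s (- x) * half_density x \<partial>lborel)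
        = (- 1) ^ s * (\<integral>x. limit_poly y s x * half_density x \<partial>lborel)" by simp
    thus ?thesis
      by (subst integral_ac_part(2)) (auto intro: continuous_intros simp: distrib_right)
  qed
  show ?thesis
  proof (cases "even s")
    case True
    then obtain k where k: "s = 2 * k" by (elim evenE)
    have "integrable lborel (\<lambda>x. limit_poly y s x * half_density x)"
      by (intro integrable_mult_half_density continuous_intros)
    hence "((\<lambda>x. limit_poly y s x * half_density x) has_integral
        (\<integral>x. limit_poly y s x * half_density x \<partial>lborel)) UNIV"
      by (rule has_integral_integral_lborel)
    hence "(\<integral>x. limit_poly y s x * half_density x \<partial>lborel) = (if k = 0 then 1 / (1 + y) else 0)"
      using has_integral_half_density[of k] unfolding k by (rule has_integral_unique)
    thus ?thesis using * k by simp
  qed (use * in \<open>auto elim: oddE\<close>)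
qed

text \<open>Orthogonality to constants removes every term but s = 0, leaving the limit of the main
  term of \<open>trace_adj_kernel\<close>.\<close>

lemma moment_ac_part:
  "(\<integral>x. x ^ j \<partial>ac_part) = 2 / (1 + y) * jacobi_coeff (limit_coeff y) j 0"
proof -
  have "(\<integral>x. x ^ j \<partial>ac_part) = (\<integral>x. (\<Sum>s\<le>j. jacobi_coeff (limit_coeff y) j s * limit_poly y s x) \<partial>ac_part)"
    by (simp only: power_eq_sum_limit_poly[of _ j y])
  also have "\<dots> = (\<Sum>s\<le>j. jacobi_coeff (limit_coeff y) j s * (\<integral>x. limit_poly y s x \<partial>ac_part))"
    by (subst Bochner_Integration.integral_sum) (auto intro!: integral_ac_part(1) continuous_intros)
  also have "\<dots> = (\<Sum>s\<in>{0}. jacobi_coeff (limit_coeff y) j s * (\<integral>x. limit_poly y s x \<partial>ac_part))"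
    by (intro sum.mono_neutral_right) (auto simp: integral_ac_part_limit_poly)
  finally show ?thesis by (simp add: integral_ac_part_limit_poly del: limit_poly.simps)
qed

lemma space_limit_measure [simp]: "space (limit_measure y) = UNIV"
  by (simp add: limit_measure_def)

text \<open>\<open>limit_measure\<close> is given by its values on sets, so integrals are reached by
  restriction: off 0 it coincides with \<open>ac_part\<close>, which does not charge 0, and at 0 it
  has the atom.\<close>

lemma integral_limit_measure:
  fixes f :: "real \<Rightarrow> real"
  assumes f: "continuous_on UNIV f"
  shows "integrable (limit_measure y) f"
    and "(\<integral>x. f x \<partial>limit_measure y) = (\<integral>x. f x \<partial>ac_part) + (y - 1) / (y + 1) * f 0"
proof -
  have [measurable]: "f \<in> borel_measurable borel" using f by (rule borel_measurable_continuous_onI)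
  have [measurable_cong]: "sets (limit_measure y) = sets borel" "sets ac_part = sets borel" by simp_all
  let ?I = "indicator (- {0}) :: real \<Rightarrow> real"
  have null: "emeasure ac_part {0} = 0"
  proof -
    have "AE x in lborel. x \<noteq> (0 :: real)" by (rule AE_lborel_singleton)
    hence "(\<integral>\<^sup>+x. ennreal (limit_density y x * indicator (limit_support y) x) * indicator {0} x \<partial>lborel) = 0"
      by (subst nn_integral_0_iff_AE) (auto simp: limit_support_def elim: eventually_mono)
    thus ?thesis unfolding ac_part_def by (subst emeasure_density) (auto simp: limit_support_def)
  qed
  have eq: "density (limit_measure y) (\<lambda>x. ennreal (?I x)) = ac_part"
  proof (rule measure_eqI)
    fix X assume "X \<in> sets (density (limit_measure y) (\<lambda>x. ennreal (?I x)))"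
    hence X: "X \<in> sets borel" by simp
    have "emeasure (density (limit_measure y) (\<lambda>x. ennreal (?I x))) X
        = (\<integral>\<^sup>+x. indicator (X - {0}) x \<partial>limit_measure y)"
    proof -
      have "ennreal (?I x) * indicator X x = indicator (X - {0}) x" for x
        by (auto simp: indicator_def)
      thus ?thesis using X by (subst emeasure_density) auto
    qed
    also have "\<dots> = emeasure (limit_measure y) (X - {0})"
      using X by (intro nn_integral_indicator) auto
    also have "\<dots> = emeasure ac_part (X - {0})"
      using X by (subst emeasure_limit_measure_ac) auto
    also have "\<dots> = emeasure ac_part X"
      using X null by (intro emeasure_Diff_null_set) (auto simp: null_sets_def)
    finally show "emeasure (density (limit_measure y) (\<lambda>x. ennreal (?I x))) X = emeasure ac_part X" .
  qed simp
  have at0: "emeasure (limit_measure y) {0} = ennreal ((y - 1) / (y + 1))"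
    by (subst emeasure_limit_measure_ac) (auto simp: null)
  have i1: "integrable (limit_measure y) (\<lambda>x. ?I x *\<^sub>R f x)"
    using integral_ac_part(1)[OF f] unfolding eq[symmetric]
    by (subst (asm) integrable_density) auto
  have i1': "(\<integral>x. ?I x *\<^sub>R f x \<partial>limit_measure y) = (\<integral>x. f x \<partial>ac_part)"
    unfolding eq[symmetric] by (subst integral_density) auto
  have i2: "integrable (limit_measure y) (\<lambda>x. indicator {0} x *\<^sub>R f 0)"
    using at0 by (intro integrable_indicator integrable_scaleR_left) (auto intro: integrable_real_indicator)
  have i2': "(\<integral>x. indicator {0} x *\<^sub>R f 0 \<partial>limit_measure y) = (y - 1) / (y + 1) * f 0"
    using at0 y by (simp add: measure_def)
  have split: "f = (\<lambda>x. ?I x *\<^sub>R f x + indicator {0} x *\<^sub>R f 0)" by (auto simp: indicator_def)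
  show "integrable (limit_measure y) f"
    by (subst split) (intro Bochner_Integration.integrable_add i1 i2)
  show "(\<integral>x. f x \<partial>limit_measure y) = (\<integral>x. f x \<partial>ac_part) + (y - 1) / (y + 1) * f 0"
    by (subst split) (simp only: Bochner_Integration.integral_add[OF i1 i2] i1' i2')
qed

lemma moment_limit_measure:
  "(\<integral>x. x ^ j \<partial>limit_measure y)
    = 2 / (1 + y) * jacobi_coeff (limit_coeff y) j 0 + (if j = 0 then (y - 1) / (y + 1) else 0)"
  by (subst integral_limit_measure(2)) (auto intro!: continuous_intros simp: moment_ac_part)

lemma prob_space_limit_measure: "prob_space (limit_measure y)"
proof
  have "integrable (limit_measure y) (\<lambda>x. 1 :: real)" by (rule integral_limit_measure(1)) auto
  hence fin: "emeasure (limit_measure y) (space (limit_measure y)) < \<infinity>"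
    by (simp add: integrable_iff_bounded)
  have "measure (limit_measure y) UNIV = (\<integral>x. x ^ 0 \<partial>limit_measure y)" by simp
  also have "\<dots> = 2 / (1 + y) + (y - 1) / (y + 1)" by (subst moment_limit_measure) simp
  also have "\<dots> = 1" using y by (simp add: add.commute[of 1 y] flip: add_divide_distrib)
  finally show "emeasure (limit_measure y) (space (limit_measure y)) = 1"
    using fin by (simp add: emeasure_eq_ennreal_measure)
qed

text \<open>The upper edge is at most 2, so the measure lives on [-2, 2]; this supplies K = 2 for
  \<open>weak_convergence_of_moments\<close>.\<close>

lemma even_moment_limit_measure_le: "(\<integral>x. x ^ (2 * j) \<partial>limit_measure y) \<le> 2 ^ (2 * j)"
proof -
  interpret prob_space "limit_measure y" by (rule prob_space_limit_measure)
  have "emeasure (limit_measure y) {x. 2 < \<bar>x\<bar>} = 0"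
  proof -
    have "{x :: real. 2 < \<bar>x\<bar>} \<in> sets borel" by measurable
    moreover have "limit_support y \<inter> {x. 2 < \<bar>x\<bar>} = {}"
      using lower_edge_nonneg upper_edge_le_2 by (auto simp: limit_support_def)
    ultimately show ?thesis by (subst emeasure_limit_measure) auto
  qed
  hence "{x. 2 < \<bar>x\<bar>} \<in> null_sets (limit_measure y)" by (auto simp: null_sets_def)
  hence "AE x in limit_measure y. \<bar>x\<bar> \<le> 2" by (rule AE_I'[of "{x. 2 < \<bar>x\<bar>}"]) auto
  hence "AE x in limit_measure y. x ^ (2 * j) \<le> 2 ^ (2 * j)"
  proof eventually_elim
    case (elim x)
    hence "\<bar>x\<bar> ^ (2 * j) \<le> 2 ^ (2 * j)" by (intro power_mono) auto
    thus ?case by (simp add: power_even_abs)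
  qed
  hence "(\<integral>x. x ^ (2 * j) \<partial>limit_measure y) \<le> (\<integral>x. 2 ^ (2 * j) \<partial>limit_measure y)"
    by (intro integral_mono_AE integral_limit_measure(1)) (auto intro!: continuous_intros)
  also have "(\<integral>x. 2 ^ (2 * j) \<partial>limit_measure y) = (2 :: real) ^ (2 * j)" using prob_space by simp
  finally show ?thesis .
qed

end

subsection \<open>Almost sure convergence\<close>

text \<open>The hypotheses on the parameters, without the graphs: convergence is proved for a
  deterministic sequence with few short cycles, and randomness enters only in showing that almost
  every sequence is of this kind.\<close>

locale biregular_degrees =
  fixes n m dL dR :: "nat \<Rightarrow> nat" and y :: real
  assumes mono: "strict_mono n"
    and balance: "\<And>k. m k * dL k = n k * dR k"
    and dL_le_dR: "\<And>k. dL k \<le> dR k"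
    and dR_at_top: "filterlim dR at_top sequentially"
    and dR_small: "\<And>\<epsilon>::real. \<epsilon> > 0 \<Longrightarrow> (\<lambda>k. real (dR k)) \<in> o(\<lambda>k. real (n k) powr \<epsilon>)"
    and ratio: "(\<lambda>k. real (dR k) / real (dL k)) \<longlonglongrightarrow> y"
    and y: "1 \<le> y"
begin

lemma n_ge: "k \<le> n k"
  by (rule strict_mono_imp_increasing[OF mono])

lemma n_at_top: "filterlim (\<lambda>k. real (n k)) at_top sequentially"
  by (rule filterlim_compose[OF filterlim_real_sequentially filterlim_subseq[OF mono]])

lemma eventually_n_ge: "\<forall>\<^sub>F k in sequentially. c \<le> real (n k)"
  using n_at_top by (simp add: filterlim_at_top)

lemma eventually_dR_ge: "\<forall>\<^sub>F k in sequentially. c \<le> dR k"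
  using dR_at_top by (simp add: filterlim_at_top)

lemma eventually_dR_le: "\<epsilon> > 0 \<Longrightarrow> \<forall>\<^sub>F k in sequentially. real (dR k) \<le> real (n k) powr \<epsilon>"
  using landau_o.smallD[OF dR_small, of \<epsilon> 1] by simp

lemma eventually_dR_power_le:
  assumes "\<epsilon> > 0"
  shows "\<forall>\<^sub>F k in sequentially. real (dR k) ^ j \<le> real (n k) powr \<epsilon>"
proof -
  \<comment> \<open>\<open>Suc j\<close> instead of j keeps the exponent meaningful for j =
    0.\<close>
  have "\<forall>\<^sub>F k in sequentially. real (dR k) \<le> real (n k) powr (\<epsilon> / Suc j)"
    using assms by (intro eventually_dR_le) simp
  thus ?thesis using eventually_n_ge[of 1]
  proof eventually_elim
  case (elim k)
  have "real (dR k) ^ j \<le> (real (n k) powr (\<epsilon> / Suc j)) ^ j" using elim by (intro power_mono) auto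
  also have "\<dots> = real (n k) powr (\<epsilon> / Suc j * real j)" using elim by (simp add: powr_power mult.commute)
  also have "\<dots> \<le> real (n k) powr \<epsilon>"
    using elim assms by (intro powr_mono) (auto simp: field_simps)
  finally show ?case .
  qed
qed

lemma eventually_small: "\<forall>\<^sub>F k in sequentially. 4 * c + 4 * (dL k * dR k) \<le> n k * dR k"
proof -
  have "\<forall>\<^sub>F k in sequentially. real (dR k) \<le> real (n k) powr (1 / 2)"
    by (intro eventually_dR_le) simp
  \<comment> \<open>From n \<ge> 64 follows 8 sqrt n \<le> n, hence 8 dL \<le> n; together with 8 c
    \<le> n each summand is at most half of n dR.\<close>
  thus ?thesis using eventually_n_ge[of "64 + 8 * real c"] eventually_dR_ge[of 1]
  proof eventually_elim
  case (elim k)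
  have "8 * sqrt (real (n k)) \<le> real (n k)"
  proof -
    have "8 = sqrt 64" by simp
    also have "\<dots> \<le> sqrt (real (n k))" using elim by (intro real_sqrt_le_mono) auto
    finally have "8 * sqrt (real (n k)) \<le> sqrt (real (n k)) * sqrt (real (n k))"
      by (intro mult_right_mono) auto
    thus ?thesis by simp
  qed
  hence "8 * real (dR k) \<le> real (n k)" using elim by (simp add: powr_half_sqrt)
  hence "8 * dL k \<le> n k" using dL_le_dR[of k] by linarith
  hence "8 * dL k * dR k \<le> n k * dR k" by (intro mult_right_mono) auto
  hence "8 * (dL k * dR k) \<le> n k * dR k" by (simp only: mult.assoc)
  moreover have "8 * c \<le> n k" using elim by linarith
  hence "8 * c * 1 \<le> n k * dR k" using elim by (intro mult_mono) auto
  ultimately show ?case by linarith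
  qed
qed

lemma eventually_dL_pos: "\<forall>\<^sub>F k in sequentially. 0 < dL k"
proof -
  \<comment> \<open>The limit y is positive, while dL = 0 would make the quotient 0 by the
    convention for division.\<close>
  have "\<forall>\<^sub>F k in sequentially. 0 < real (dR k) / real (dL k)"
    using order_tendstoD(1)[OF ratio, of 0] y by simp
  thus ?thesis by eventually_elim (auto intro: gr0I)
qed

lemma tendsto_inverse_dR: "(\<lambda>k. 1 / real (dR k)) \<longlonglongrightarrow> 0"
  using filterlim_compose[OF filterlim_real_sequentially dR_at_top]
  by (rule tendsto_divide_0[OF tendsto_const filterlim_at_top_imp_at_infinity])

lemma tendsto_walk_coeff: "(\<lambda>k. walk_coeff (dL k) (dR k) s) \<longlonglongrightarrow> limit_coeff y s"
proof -
  have "(\<lambda>k. 1 / (real (dR k) / real (dL k)) - 1 / real (dR k)) \<longlonglongrightarrow> 1 / y - 0"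
    using y by (intro tendsto_intros ratio tendsto_inverse_dR) auto
  hence even: "(\<lambda>k. (real (dL k) - 1) / real (dR k)) \<longlonglongrightarrow> 1 / y"
    by (simp add: diff_divide_distrib)
  have "(\<lambda>k. 1 - 1 / real (dR k)) \<longlonglongrightarrow> 1 - 0" by (intro tendsto_intros tendsto_inverse_dR)
  moreover have "\<forall>\<^sub>F k in sequentially. 1 - 1 / real (dR k) = (real (dR k) - 1) / real (dR k)"
    using eventually_dR_ge[of 1] by eventually_elim (simp add: diff_divide_distrib)
  ultimately have odd: "(\<lambda>k. (real (dR k) - 1) / real (dR k)) \<longlonglongrightarrow> 1"
    using Lim_transform_eventually by fastforce
  show ?thesis using even odd by (simp add: walk_coeff_def limit_coeff_def)
qed

lemma tendsto_side_ratio: "(\<lambda>k. real (n k) / real (m k + n k)) \<longlonglongrightarrow> 1 / (1 + y)"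
proof -
  have "(\<lambda>k. 1 / (1 + real (dR k) / real (dL k))) \<longlonglongrightarrow> 1 / (1 + y)"
    using y by (intro tendsto_intros ratio) auto
  moreover have "\<forall>\<^sub>F k in sequentially. 1 / (1 + real (dR k) / real (dL k)) = real (n k) / real (m k + n k)"
    using eventually_dL_pos eventually_n_ge[of 1]
  proof eventually_elim
    case (elim k)
    have "real (m k) * real (dL k) = real (n k) * real (dR k)"
      using balance[of k] by (metis of_nat_mult)
    hence "real (dR k) / real (dL k) = real (m k) / real (n k)" using elim by (simp add: field_simps)
    thus ?case using elim by (simp add: field_simps)
  qed
  ultimately show ?thesis by (rule Lim_transform_eventually)
qed

text \<open>For positive j the moment is 2 n / (m + n) times \<open>c k 0\<close>, up to a power of
  \<open>dR\<close> times the number of short cycles over n. The moment j = 0 is total mass, to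
  which the trace identity does not apply.\<close>

lemma tendsto_moment_esd:
  assumes E: "\<And>k. E k \<in> biregular_graphs (m k) (n k) (dL k) (dR k)"
    and cyc: "\<And>c. 3 \<le> c \<Longrightarrow>
      \<forall>\<^sub>F k in sequentially. real (card (cycles {..<m k + n k} c (E k))) < real (n k) powr (3 / 4)"
  shows "(\<lambda>k. \<integral>x. x ^ j \<partial>esd ((1 / sqrt (real (dR k))) \<cdot>\<^sub>m adjacency_mat (m k + n k) (E k)))
    \<longlonglongrightarrow> (\<integral>x. x ^ j \<partial>limit_measure y)"
proof (cases j)
  case 0
  show ?thesis
    using 0 prob_space.prob_space[OF prob_space_limit_measure[OF y]]
    by (simp add: prob_space.prob_space[OF prob_space_esd])
next
  case (Suc i)
  define \<mu> where "\<mu> k = (\<integral>x. x ^ j \<partial>esd ((1 / sqrt (real (dR k))) \<cdot>\<^sub>m adjacency_mat (m k + n k) (E k)))" for k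
  define c where "c k s = jacobi_coeff (walk_coeff (dL k) (dR k)) j s" for k s
  have c: "(\<lambda>k. c k s) \<longlonglongrightarrow> jacobi_coeff (limit_coeff y) j s" for s
    unfolding c_def by (intro tendsto_jacobi_coeff tendsto_walk_coeff)
  define X where "X k s l = real (dR k) ^ (2 * s) * real (card (cycles {..<m k + n k} l (E k))) / real (n k)" for k s l
  have X: "(\<lambda>k. X k s l) \<longlonglongrightarrow> 0" if l: "3 \<le> l" for s l
  proof (rule tendsto_sandwich)
    show "\<forall>\<^sub>F k in sequentially. 0 \<le> X k s l" by (simp add: X_def)
    \<comment> \<open>The exponent is 1/8 for the power of \<open>dR\<close>, plus 3/4 for the
      cycles, minus 1.\<close>
    show "\<forall>\<^sub>F k in sequentially. X k s l \<le> real (n k) powr (- 1 / 8)"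
    proof -
      have "\<forall>\<^sub>F k in sequentially. real (dR k) ^ (2 * s) \<le> real (n k) powr (1 / 8)"
        by (intro eventually_dR_power_le) simp
      thus ?thesis using cyc[OF l] eventually_n_ge[of 1]
    proof eventually_elim
      case (elim k)
      have "real (dR k) ^ (2 * s) * real (card (cycles {..<m k + n k} l (E k)))
          \<le> real (n k) powr (1 / 8) * real (n k) powr (3 / 4)"
        using elim by (intro mult_mono) auto
      hence "X k s l \<le> real (n k) powr (1 / 8) * real (n k) powr (3 / 4) / real (n k) powr 1"
        using elim unfolding X_def by (simp add: divide_right_mono)
      also have "\<dots> = real (n k) powr (1 / 8 + 3 / 4 - 1)"
        by (simp only: powr_add powr_diff)
      finally show ?case by simp
    qed
    qed
    show "(\<lambda>k. real (n k) powr (- 1 / 8)) \<longlonglongrightarrow> 0"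
      using n_at_top by (intro tendsto_neg_powr) auto
  qed auto
  define err where "err k = 2 * (\<Sum>s=1..j. \<bar>c k s\<bar> * (real (Suc s) * (\<Sum>l=3..s. X k s l)))" for k
  have "err \<longlonglongrightarrow> 2 * (\<Sum>s=1..j. \<bar>jacobi_coeff (limit_coeff y) j s\<bar> * (real (Suc s) * (\<Sum>l=3..s. 0)))"
    unfolding err_def by (intro tendsto_intros c X) auto
  hence err: "err \<longlonglongrightarrow> 0" by simp
  have bound: "\<forall>\<^sub>F k in sequentially.
      norm (\<mu> k - 2 * (real (n k) / real (m k + n k)) * c k 0) \<le> err k"
    using eventually_dR_ge[of 1] eventually_n_ge[of 1]
  proof eventually_elim
    case (elim k)
    let ?N = "real (m k + n k)"
    let ?T = "kernel_apply {..<m k + n k} (adj_kernel (1 / sqrt (real (dR k))) (E k))"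
    define tr where "tr = (\<Sum>v<m k + n k. (?T ^^ j) (unit_at v) v)"
    have N: "0 < m k + n k" using elim by simp
    have \<mu>: "\<mu> k = tr / ?N" unfolding \<mu>_def tr_def by (rule moment_esd[OF N])
    have "\<bar>tr - 2 * real (n k) * c k 0\<bar> \<le> 2 * (\<Sum>s=1..j. \<bar>c k s\<bar> * (real (Suc s) * real (dR k) ^ (2 * s) *
         (\<Sum>l=3..s. real (card (cycles {..<m k + n k} l (E k))))))"
      using trace_adj_kernel[OF E _ dL_le_dR, of k i] elim unfolding tr_def c_def Suc by simp
    also have "\<dots> = real (n k) * err k"
    proof -
      have nX: "real (dR k) ^ (2 * s) * real (card (cycles {..<m k + n k} l (E k))) = real (n k) * X k s l" for s l
        using elim by (simp add: X_def)
      define Z where "Z s = real (Suc s) * (\<Sum>l=3..s. X k s l)" for s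
      have "real (Suc s) * real (dR k) ^ (2 * s) * (\<Sum>l=3..s. real (card (cycles {..<m k + n k} l (E k))))
          = real (n k) * Z s" for s
        unfolding Z_def mult.assoc[of "real (Suc s)"] sum_distrib_left[of "real (dR k) ^ (2 * s)"] nX
        by (simp only: sum_distrib_left[symmetric] mult.left_commute[of "real (Suc s)" "real (n k)"])
      thus ?thesis unfolding err_def Z_def[symmetric]
        by (simp only: sum_distrib_left mult.left_commute[of _ "real (n k)"])
    qed
    finally have le: "\<bar>tr - 2 * real (n k) * c k 0\<bar> \<le> real (n k) * err k" .
    have "0 \<le> err k" by (auto simp: err_def X_def intro!: sum_nonneg mult_nonneg_nonneg)
    hence "real (n k) * err k \<le> ?N * err k" by (intro mult_right_mono) auto
    hence "\<bar>tr - 2 * real (n k) * c k 0\<bar> \<le> err k * ?N" using le by (simp only: mult.commute)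
    moreover have Npos: "0 < ?N" using N by (simp only: of_nat_0_less_iff)
    ultimately have "\<bar>tr - 2 * real (n k) * c k 0\<bar> / ?N \<le> err k" by (simp only: pos_divide_le_eq)
    moreover have "\<mu> k - 2 * (real (n k) / ?N) * c k 0 = (tr - 2 * real (n k) * c k 0) / ?N"
      by (simp add: \<mu> diff_divide_distrib)
    ultimately show ?case using Npos by (simp add: abs_divide)
  qed
  have "(\<lambda>k. (\<mu> k - 2 * (real (n k) / real (m k + n k)) * c k 0) + 2 * (real (n k) / real (m k + n k)) * c k 0)
      \<longlonglongrightarrow> 0 + 2 * (1 / (1 + y)) * jacobi_coeff (limit_coeff y) j 0"
    by (intro tendsto_add tendsto_mult tendsto_const tendsto_side_ratio c Lim_null_comparison[OF bound err])
  moreover have "(\<integral>x. x ^ j \<partial>limit_measure y) = 0 + 2 * (1 / (1 + y)) * jacobi_coeff (limit_coeff y) j 0"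
    unfolding moment_limit_measure[OF y] using Suc by (simp del: jacobi_coeff.simps)
  ultimately show ?thesis unfolding \<mu>_def by simp
qed

lemma tendsto_integral_esd:
  fixes f :: "real \<Rightarrow> real"
  assumes E: "\<And>k. E k \<in> biregular_graphs (m k) (n k) (dL k) (dR k)"
    and cyc: "\<And>c. 3 \<le> c \<Longrightarrow>
      \<forall>\<^sub>F k in sequentially. real (card (cycles {..<m k + n k} c (E k))) < real (n k) powr (3 / 4)"
    and f: "continuous_on UNIV f" "bounded (range f)"
  shows "(\<lambda>k. \<integral>x. f x \<partial>esd ((1 / sqrt (real (dR k))) \<cdot>\<^sub>m adjacency_mat (m k + n k) (E k)))
    \<longlonglongrightarrow> (\<integral>x. f x \<partial>limit_measure y)"
proof -
  define A where "A k = (1 / sqrt (real (dR k))) \<cdot>\<^sub>m adjacency_mat (m k + n k) (E k)" for k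
  have A: "A k \<in> carrier_mat (m k + n k) (m k + n k)" for k by (simp add: A_def)
  have sym: "(A k)\<^sup>T = A k" for k
    unfolding A_def by (intro eq_matI) (auto simp: adjacency_mat_def insert_commute)
  \<comment> \<open>The index is shifted because \<open>n 0\<close> may be 0, and the spectral
    distribution of an empty matrix has no controlled moments.\<close>
  have "(\<lambda>k. \<integral>x. f x \<partial>esd (A (Suc k))) \<longlonglongrightarrow> (\<integral>x. f x \<partial>limit_measure y)"
  proof (rule weak_convergence_of_moments[OF prob_space_esd _ _ prob_space_limit_measure[OF y] _ _ _ _ _ f])
    show "integrable (esd (A (Suc k))) (\<lambda>x. x ^ j)" for k j
      using n_ge[of "Suc k"] by (intro integrable_esd[OF A sym]) auto
    show "integrable (limit_measure y) (\<lambda>x. x ^ j)" for j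
      by (intro integral_limit_measure(1)[OF y] continuous_intros)
    show "(\<integral>x. x ^ (2 * j) \<partial>limit_measure y) \<le> 2 ^ (2 * j)" for j
      by (rule even_moment_limit_measure_le[OF y])
    show "(\<lambda>k. \<integral>x. x ^ j \<partial>esd (A (Suc k))) \<longlonglongrightarrow> (\<integral>x. x ^ j \<partial>limit_measure y)" for j
      using LIMSEQ_Suc[OF tendsto_moment_esd[OF E cyc]] unfolding A_def .
  qed simp_all
  thus ?thesis unfolding A_def by (rule LIMSEQ_imp_Suc)
qed

text \<open>Chebyshev's inequality at the threshold n^(3/4) gives a probability of order n^(1/4 -
  3/2) = n^(-5/4), the 1/4 absorbing \<open>dR ^ (2 * c)\<close>. Since n k \<ge> k this is summable
  in k, and the first Borel-Cantelli lemma holds for any joint law of the graphs.\<close>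

lemma AE_few_cycles:
  fixes M :: "'w measure" and G :: "nat \<Rightarrow> 'w \<Rightarrow> nat set set"
  assumes "prob_space M"
    and G: "\<And>k. random_biregular_graph M (m k) (n k) (dL k) (dR k) (G k)"
    and c: "3 \<le> c"
  shows "AE \<omega> in M. \<forall>\<^sub>F k in sequentially.
    real (card (cycles {..<m k + n k} c (G k \<omega>))) < real (n k) powr (3 / 4)"
proof -
  interpret prob_space M by fact
  let ?\<Omega> = "\<lambda>k. biregular_graphs (m k) (n k) (dL k) (dR k)"
  define B where "B k = {E \<in> ?\<Omega> k. real (n k) powr (3 / 4) \<le> real (card (cycles {..<m k + n k} c E))}" for k
  define A where "A k = G k -` B k \<inter> space M" for k
  have Gm: "G k \<in> M \<rightarrow>\<^sub>M count_space (?\<Omega> k)"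
    and Gd: "distr M (count_space (?\<Omega> k)) (G k) = uniform_count_measure (?\<Omega> k)" for k
    using G[of k] by (auto simp: random_biregular_graph_def)
  have B: "B k \<subseteq> ?\<Omega> k" for k by (auto simp: B_def)
  have A: "A k \<in> sets M" for k
    unfolding A_def using B by (intro measurable_sets[OF Gm]) auto
  have prob: "measure M (A k) = real (card (B k)) / real (card (?\<Omega> k))" for k
  proof -
    have "measure M (A k) = measure (distr M (count_space (?\<Omega> k)) (G k)) (B k)"
      unfolding A_def using B by (intro measure_distr[symmetric] Gm) auto
    also have "\<dots> = real (card (B k)) / real (card (?\<Omega> k))"
      unfolding Gd by (rule measure_uniform_count_measure[OF finite_biregular_graphs B])
    finally show ?thesis .
  qed
  define K where "K = (4 ^ (2 * c) * fact (2 * c) :: real)"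
  have "summable (\<lambda>k. measure M (A k))"
  proof (rule summable_comparison_test_ev)
    show "summable (\<lambda>k. K * real k powr (- 5 / 4))"
      by (intro summable_mult) (simp add: summable_real_powr_iff)
    show "\<forall>\<^sub>F k in sequentially. norm (measure M (A k)) \<le> K * real k powr (- 5 / 4)"
    proof -
      have "\<forall>\<^sub>F k in sequentially. real (dR k) ^ (2 * c) \<le> real (n k) powr (1 / 4)"
        by (intro eventually_dR_power_le) simp
      thus ?thesis using eventually_small[of c] eventually_dR_ge[of 1] eventually_gt_at_top[of 0]
    proof eventually_elim
      case (elim k)
      have n: "0 < n k" using elim n_ge[of k] by simp
      have "real (card (B k)) \<le> (4 * real (dR k)) ^ (2 * c) * fact (2 * c) / (real (n k) powr (3 / 4))\<^sup>2 * real (card (?\<Omega> k))"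
        unfolding B_def using elim n
        by (intro card_many_cycles_le[OF c balance dL_le_dR]) auto
      hence "measure M (A k) \<le> (4 * real (dR k)) ^ (2 * c) * fact (2 * c) / (real (n k) powr (3 / 4))\<^sup>2"
        unfolding prob by (cases "card (?\<Omega> k) = 0") (auto simp: divide_le_eq)
      also have "\<dots> = K * (real (dR k) ^ (2 * c) / real (n k) powr (3 / 2))"
        using n by (simp add: K_def power_mult_distrib powr_power)
      also have "\<dots> \<le> K * (real (n k) powr (1 / 4) / real (n k) powr (3 / 2))"
        using elim by (intro mult_left_mono divide_right_mono) (auto simp: K_def)
      also have "real (n k) powr (1 / 4) / real (n k) powr (3 / 2) = real (n k) powr (- 5 / 4)"
        by (simp flip: powr_diff)
      also have "real (n k) powr (- 5 / 4) \<le> real k powr (- 5 / 4)"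
        using elim n_ge[of k] by (intro powr_mono2') auto
      finally show ?case by (simp add: K_def mult_left_mono)
    qed
    qed
  qed
  hence "AE \<omega> in M. \<forall>\<^sub>F k in sequentially. \<omega> \<in> space M - A k"
    by (intro borel_cantelli_AE1 A) (auto simp: emeasure_eq_measure)
  thus ?thesis
  proof eventually_elim
    case (elim \<omega>)
    thus ?case
    proof eventually_elim
      case (elim k)
      thus ?case using measurable_space[OF Gm[of k], of \<omega>] by (auto simp: A_def B_def)
    qed
  qed
qed

end

theorem corollary2:
  fixes M :: "'w measure"
    and n m dL dR :: "nat \<Rightarrow> nat"
    and G :: "nat \<Rightarrow> 'w \<Rightarrow> nat set set"
    and y :: real
  assumes "prob_space M"
    and "strict_mono n"
    and "\<And>k. m k * dL k = n k * dR k"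
    and "\<And>k. dL k \<le> dR k"
    and "\<And>k. random_biregular_graph M (m k) (n k) (dL k) (dR k) (G k)"
    and "filterlim dR at_top sequentially"
    and "\<And>\<epsilon>::real. \<epsilon> > 0 \<Longrightarrow> (\<lambda>k. real (dR k)) \<in> o(\<lambda>k. real (n k) powr \<epsilon>)"
    and "(\<lambda>k. real (dR k) / real (dL k)) \<longlonglongrightarrow> y"
    and "1 \<le> y"
  shows "converges_AS M
           (\<lambda>k \<omega>. esd ((1 / sqrt (real (dR k))) \<cdot>\<^sub>m adjacency_mat (m k + n k) (G k \<omega>)))
           (limit_measure y)"
proof -
  interpret biregular_degrees n m dL dR y
    by unfold_locales (fact assms)+
  have "AE \<omega> in M. \<forall>c. 3 \<le> c \<longrightarrow> (\<forall>\<^sub>F k in sequentially.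
      real (card (cycles {..<m k + n k} c (G k \<omega>))) < real (n k) powr (3 / 4))"
    using AE_few_cycles[OF assms(1) assms(5)] by (subst AE_all_countable) auto
  \<comment> \<open>Only the cycle counts, over countably many lengths, cost null sets; outside
    their union the convergence is deterministic and holds for all f at once.\<close>
  hence "AE \<omega> in M. \<forall>f :: real \<Rightarrow> real. continuous_on UNIV f \<and> bounded (range f) \<longrightarrow>
      (\<lambda>k. \<integral>x. f x \<partial>esd ((1 / sqrt (real (dR k))) \<cdot>\<^sub>m adjacency_mat (m k + n k) (G k \<omega>)))
        \<longlonglongrightarrow> (\<integral>x. f x \<partial>limit_measure y)"
    using AE_space
  proof eventually_elim
    case (elim \<omega>)
    have "G k \<omega> \<in> biregular_graphs (m k) (n k) (dL k) (dR k)" for k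
    proof -
      have "G k \<in> M \<rightarrow>\<^sub>M count_space (biregular_graphs (m k) (n k) (dL k) (dR k))"
        using assms(5)[of k] by (simp add: random_biregular_graph_def)
      from measurable_space[OF this elim(2)] show ?thesis by simp
    qed
    thus ?case using elim(1) tendsto_integral_esd[of "\<lambda>k. G k \<omega>"] by blast
  qed
  thus ?thesis unfolding converges_AS_def by (auto elim: eventually_mono)
qed

end
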